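(* Let $a,b\ge 2$ be integers, and let $g_n=\gcd(a^n-1,b^n-1)$ for $n\ge 1$. The following are equivalent: (1) $a$ and $b$ are multiplicatively dependent; (2) the sequence $(g_n)_{n\ge 1}$ satisfies a constant-coefficient linear recurrence; (3) for some integer $N\ge 0$, the tail $(g_{n+N})_{n\ge 1}$ satisfies a constant-coefficient linear recurrence. If these conditions hold, then there are integers $c\ge 2$ and $r,s\ge 1$ such that $a=c^r$ and $b=c^s$. Writing $d=\gcd(r,s)$, one has $g_n=c^{dn}-1$ for all $n\ge 1$.
   Context: Positive integers $a$ and $b$ are multiplicatively dependent if $a^u=b^v$ for some positive integers $u,v$; otherwise they are multiplicatively independent. A sequence $(u_n)_{n\ge 1}$ of integers satisfies a constant-coefficient linear recurrence if there exist an integer $d\ge 1$ and integers $c_1,\dots,c_d$ such that $u_{n+d}=c_1u_{n+d-1}+\cdots+c_du_n$ for all $n\ge 1$. The trailing coefficient $c_d$ is allowed to be zero. *)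

theory Defs
  imports Complex_Main
begin

definition mult_dependent :: "int \<Rightarrow> int \<Rightarrow> bool" where
  "mult_dependent a b \<longleftrightarrow> (\<exists>u v :: nat. u \<ge> 1 \<and> v \<ge> 1 \<and> a ^ u = b ^ v)"

text \<open>A sequence $(u_n)_{n \ge 1}$ is a function on \<^typ>\<open>nat\<close> whose value at \<open>0\<close> is ignored: the
  recurrence is only required from index \<open>1\<close> on. The trailing coefficient \<open>c d\<close> may be zero.
  The subtraction \<open>n + d - i\<close> never truncates, since \<open>i \<le> d\<close>.\<close>

definition satisfies_lin_rec :: "(nat \<Rightarrow> int) \<Rightarrow> bool" where
  "satisfies_lin_rec u \<longleftrightarrow>
     (\<exists>(d :: nat) (c :: nat \<Rightarrow> int). d \<ge> 1 \<and>
        (\<forall>n\<ge>1. u (n + d) = (\<Sum>i = 1..d. c i * u (n + d - i))))"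

definition gcd_seq :: "int \<Rightarrow> int \<Rightarrow> nat \<Rightarrow> int" where
  "gcd_seq a b n = gcd (a ^ n - 1) (b ^ n - 1)"

end

theory Submission
  imports Defs "HOL-Computational_Algebra.Computational_Algebra"
    "HOL-Computational_Algebra.Field_as_Ring"
begin

text \<open>
  Write \<open>g n\<close> for \<open>gcd (a ^ n - 1) (b ^ n - 1)\<close>. If \<open>a\<close> and \<open>b\<close> are dependent, they are powers
  of one integer \<open>c\<close>, and \<open>gcd (c ^ i - 1) (c ^ j - 1) = c ^ gcd i j - 1\<close> gives the formula for
  \<open>g\<close> and a recurrence of order two. The substance is that for independent \<open>a\<close> and \<open>b\<close> no tail
  of \<open>g\<close> is linearly recurrent. It rests on the size of \<open>g\<close>, on the integrality of \<open>g\<close>, and on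
  the fact that a large prime \<open>p\<close> divides \<open>g n\<close> whenever \<open>p - 1\<close> divides \<open>n\<close>.

  \<^emph>\<open>Size.\<close> Modulo \<open>g n\<close>, all monomials \<open>a ^ i * b ^ j\<close> are \<open>n\<close>-th roots of unity. A Vandermonde
  product of \<open>K\<close> such roots is divisible by the \<open>(K - n)\<close>-th power of the modulus
  (\<open>power_dvd_diffprod\<close>). For independent \<open>a\<close> and \<open>b\<close> the monomials are distinct, so one nonzero
  Vandermonde product of about \<open>2 * N\<close> small monomials is divisible by a high power of every \<open>g n\<close>
  with \<open>n \<le> N\<close>. Since \<open>gcd (g m) (g n) = g (gcd m n)\<close>, these powers are nearly coprime for
  \<open>n\<close> in a short interval, and their product nearly divides the Vandermonde product. Comparing sizes
  shows that \<open>g n\<close> can be exponentially large only on a sparse set: for every \<open>\<delta> > 0\<close> there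
  are arbitrarily long runs of consecutive \<open>n\<close> with \<open>g n < exp (\<delta> * n)\<close>
  (\<open>exists_run_of_small_gcds\<close>). Such a bound for all large \<open>n\<close> lies much deeper; runs suffice here.

  \<^emph>\<open>Integrality.\<close> Suppose that \<open>g\<close> is eventually linearly recurrent, and let \<open>\<mu>\<close> be its minimal
  characteristic polynomial over the rationals. A root of \<open>\<mu>\<close> outside the unit disc would force
  exponential growth in every window of \<open>degree \<mu>\<close> consecutive terms, so all roots lie in the closed
  unit disc. Removing the multiplicities from \<open>\<mu>\<close> turns \<open>g\<close> into a bounded integer sequence,
  which is eventually periodic with some period \<open>M\<close>. Hence all roots of \<open>\<mu>\<close> are \<open>M\<close>-th
  roots of unity, and a power of \<open>x ^ M - 1\<close> annihilates \<open>g\<close> (\<open>unity_roots_if_slow_growth\<close>).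

  \<^emph>\<open>Primes.\<close> If \<open>(x ^ M - 1) ^ D\<close> annihilates \<open>g\<close> and \<open>p \<ge> D\<close> is an odd prime, then so does
  \<open>(x ^ M - 1) ^ p\<close>, which is \<open>x ^ (M * p) - 1\<close> modulo \<open>p\<close>; thus \<open>g (n + M * p) \<equiv> g n\<close>
  modulo \<open>p\<close>. For a fixed suitable \<open>n\<close>, repeated shifts by \<open>M * p\<close> reach a multiple of \<open>p - 1\<close>,
  where \<open>p\<close> divides \<open>g\<close>. So every large prime divides the one positive integer \<open>g n\<close>, which is
  absurd (\<open>gcd_seq_not_unipotent\<close>).
\<close>

section \<open>Lagrange interpolation\<close>

lemma lagrange_interpolation:
  fixes x :: "'i \<Rightarrow> 'a::field" and f :: "'a poly"
  assumes "finite S" "inj_on x S" "degree f < card S"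
  shows "f = (\<Sum>i\<in>S. smult (poly f (x i) / (\<Prod>j\<in>S-{i}. x i - x j)) (\<Prod>j\<in>S-{i}. [:- x j, 1:]))"
    (is "f = ?L")
proof (rule poly_eqI_degree[where A = "x ` S"])
  have card: "card (x ` S) = card S" using assms by (simp add: card_image)
  show "degree f < card (x ` S)" using assms card by simp
  have "degree (\<Prod>j\<in>S-{i}. [:- x j, 1:]) \<le> card S - 1" if "i \<in> S" for i
  proof -
    have "degree (\<Prod>j\<in>S-{i}. [:- x j, 1:]) \<le> sum (degree \<circ> (\<lambda>j. [:- x j, 1:])) (S-{i})"
      by (rule degree_prod_sum_le) (use assms in auto)
    also have "\<dots> = card S - 1" using that assms by simp
    finally show ?thesis .
  qed
  then have "degree ?L \<le> card S - 1"
    by (intro degree_sum_le) (auto intro: order_trans[OF degree_smult_le] simp: assms)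
  then show "degree ?L < card (x ` S)" using assms card by linarith
  fix z assume "z \<in> x ` S"
  then obtain i where i: "i \<in> S" "z = x i" by auto
  have "poly ?L z = (\<Sum>k\<in>S. if k = i then poly f z else 0)"
    unfolding poly_sum
  proof (rule sum.cong[OF refl])
    fix k assume k: "k \<in> S"
    show "poly (smult (poly f (x k) / (\<Prod>j\<in>S-{k}. x k - x j)) (\<Prod>j\<in>S-{k}. [:- x j, 1:])) z
      = (if k = i then poly f z else 0)"
    proof (cases "k = i")
      case True
      have "(\<Prod>j\<in>S-{k}. x k - x j) \<noteq> 0"
        using assms k by (auto simp: inj_on_def)
      then show ?thesis using True i by (simp add: poly_prod)
    next
      case False
      have "(\<Prod>j\<in>S-{k}. z - x j) = 0"
        using assms i False by (intro prod_zero) auto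
      then show ?thesis using False by (simp add: poly_prod)
    qed
  qed
  also have "\<dots> = poly f z" using i assms by simp
  finally show "poly f z = poly ?L z" by simp
qed

text \<open>
  Each Lagrange basis polynomial has leading coefficient one over its normalising product, so comparing
  the coefficients of degree \<open>card S - 1\<close> in the interpolation formula gives this identity. It is the
  form in which interpolation acts as the expansion of a Vandermonde determinant along a column.
\<close>

lemma lagrange_top_coeff:
  fixes x :: "'i \<Rightarrow> 'a::field" and f :: "'a poly"
  assumes "finite S" "inj_on x S" "degree f < card S"
  shows "coeff f (card S - 1) = (\<Sum>i\<in>S. poly f (x i) / (\<Prod>j\<in>S-{i}. x i - x j))"
proof -
  have "coeff (\<Prod>j\<in>S-{i}. [:- x j, 1:]) (card S - 1) = 1" if "i \<in> S" for i
  proof -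
    have "degree (\<Prod>j\<in>S-{i}. [:- x j, 1:]) = (\<Sum>j\<in>S-{i}. degree [:- x j, 1:])"
      by (rule degree_prod_eq_sum_degree) auto
    then have "degree (\<Prod>j\<in>S-{i}. [:- x j, 1:]) = card S - 1" using that assms by simp
    moreover have "lead_coeff (\<Prod>j\<in>S-{i}. [:- x j, 1:]) = 1"
      by (simp add: lead_coeff_prod)
    ultimately show ?thesis by simp
  qed
  then show ?thesis
    by (subst lagrange_interpolation[OF assms]) (simp add: coeff_sum)
qed

section \<open>Vandermonde products modulo an integer\<close>

text \<open>
  This is the Vandermonde determinant of the elements of \<open>S\<close>, with the sign fixed by ordering the
  elements.
\<close>

definition diffprod :: "int set \<Rightarrow> int" where
  "diffprod S = (\<Prod>x\<in>S. \<Prod>y\<in>{y\<in>S. y < x}. x - y)"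

lemma diffprod_pos: "diffprod S > 0"
  unfolding diffprod_def by (intro prod_pos) auto

lemma diffprod_remove:
  assumes "finite S" "z \<in> S"
  shows "diffprod S = diffprod (S - {z}) * (\<Prod>y\<in>S-{z}. \<bar>z - y\<bar>)"
proof -
  have inner: "(\<Prod>y\<in>{y\<in>S. y < x}. x - y)
      = (if z < x then x - z else 1) * (\<Prod>y\<in>{y\<in>S-{z}. y < x}. x - y)" for x
  proof (cases "z < x")
    case True
    then have "{y\<in>S. y < x} = insert z {y\<in>S-{z}. y < x}" using assms by auto
    then show ?thesis using True assms by simp
  next
    case False
    then have "{y\<in>S. y < x} = {y\<in>S-{z}. y < x}" by auto
    then show ?thesis using False by simp
  qed
  have z: "(\<Prod>y\<in>{y\<in>S. y < z}. z - y) = (\<Prod>y\<in>S-{z}. if y < z then z - y else 1)"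
  proof -
    have "{y\<in>S. y < z} = {y\<in>S-{z}. y < z}" by auto
    then show ?thesis using assms by (simp only: prod.inter_filter finite_Diff)
  qed
  have "diffprod S = (\<Prod>y\<in>{y\<in>S. y < z}. z - y) * (\<Prod>x\<in>S-{z}. \<Prod>y\<in>{y\<in>S. y < x}. x - y)"
    unfolding diffprod_def using assms by (rule prod.remove)
  also have "\<dots> = (\<Prod>y\<in>S-{z}. if y < z then z - y else 1)
      * ((\<Prod>x\<in>S-{z}. if z < x then x - z else 1) * diffprod (S-{z}))"
    unfolding z diffprod_def by (simp only: inner prod.distrib)
  also have "\<dots> = diffprod (S-{z}) *
      (\<Prod>y\<in>S-{z}. (if y < z then z - y else 1) * (if z < y then y - z else 1))"
    by (simp add: prod.distrib)
  also have "(\<Prod>y\<in>S-{z}. (if y < z then z - y else 1) * (if z < y then y - z else 1))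
      = (\<Prod>y\<in>S-{z}. \<bar>z - y\<bar>)"
    by (rule prod.cong) auto
  finally show ?thesis .
qed

lemma poly_map_poly_of_int:
  "poly (map_poly of_int p) (of_int x) = (of_int (poly p x) :: 'a::comm_ring_1)"
  by (induction p) (simp_all add: map_poly_pCons)

text \<open>
  Cofactor expansion of the Vandermonde determinant along its last column, after column operations have
  replaced that column by the values of the monic polynomial \<open>p\<close> of degree \<open>card S - 1\<close>.
\<close>

lemma diffprod_expand:
  fixes f :: "int \<Rightarrow> int"
  assumes S: "finite S" and p: "degree p < card S" "coeff p (card S - 1) = 1"
  shows "diffprod S = (\<Sum>x\<in>S. poly p x * sgn (\<Prod>y\<in>S-{x}. x - y) * diffprod (S-{x}))"
proof -
  let ?q = "map_poly rat_of_int p"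
  have "coeff ?q (card S - 1) = (\<Sum>x\<in>S. poly ?q (rat_of_int x) / (\<Prod>y\<in>S-{x}. rat_of_int x - rat_of_int y))"
    by (rule lagrange_top_coeff)
       (use S p in \<open>auto simp: inj_on_def intro: le_less_trans[OF map_poly_degree_leq]\<close>)
  then have 1: "1 = (\<Sum>x\<in>S. rat_of_int (poly p x) / rat_of_int (\<Prod>y\<in>S-{x}. x - y))"
    using p by (simp add: coeff_map_poly poly_map_poly_of_int)
  have "rat_of_int (diffprod S) = (\<Sum>x\<in>S. rat_of_int (diffprod S) * (rat_of_int (poly p x) / rat_of_int (\<Prod>y\<in>S-{x}. x - y)))"
    unfolding sum_distrib_left[symmetric] 1[symmetric] by simp
  also have "\<dots> = (\<Sum>x\<in>S. rat_of_int (poly p x * sgn (\<Prod>y\<in>S-{x}. x - y) * diffprod (S-{x})))"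
  proof (rule sum.cong[OF refl])
    fix x assume x: "x \<in> S"
    let ?D = "\<Prod>y\<in>S-{x}. x - y"
    have D: "?D \<noteq> 0" using S by auto
    have "(\<Prod>y\<in>S-{x}. \<bar>x - y\<bar>) = sgn ?D * ?D"
      by (metis abs_prod abs_sgn mult.commute)
    then have "diffprod S = diffprod (S-{x}) * (sgn ?D * ?D)"
      using diffprod_remove[OF S x] by (simp only:)
    then show "rat_of_int (diffprod S) * (rat_of_int (poly p x) / rat_of_int ?D)
       = rat_of_int (poly p x * sgn ?D * diffprod (S-{x}))"
      using D by (simp del: of_int_prod of_int_diff)
  qed
  also have "\<dots> = rat_of_int (\<Sum>x\<in>S. poly p x * sgn (\<Prod>y\<in>S-{x}. x - y) * diffprod (S-{x}))"
    by simp
  finally show ?thesis by (simp only: of_int_eq_iff)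
qed

text \<open>
  The elements of \<open>S\<close> are roots modulo \<open>g\<close> of the monic polynomial \<open>x ^ n - 1\<close>. As long as more
  than \<open>n\<close> elements are left, one can expand along a column of values of a monic multiple of
  \<open>x ^ n - 1\<close>. All these values are divisible by \<open>g\<close>, so every expansion step that removes one
  element contributes one factor \<open>g\<close>.
\<close>

lemma power_dvd_diffprod:
  assumes "finite S" "n \<ge> 1" "\<And>x. x \<in> S \<Longrightarrow> g dvd x ^ n - 1"
  shows "g ^ (card S - n) dvd diffprod S"
  using assms
proof (induction "card S" arbitrary: S)
  case (Suc k)
  show ?case
  proof (cases "card S \<le> n")
    case False
    \<comment> \<open>The monic multiple of \<open>x ^ n - 1\<close> of degree \<open>k = card S - 1\<close>.\<close>
    let ?p = "monom 1 (k - n) * (monom 1 n - 1) :: int poly"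
    have kn: "k \<ge> n" "card S = Suc k" using False Suc by auto
    have p: "?p = monom 1 k - monom 1 (k - n)"
      using kn by (simp add: algebra_simps mult_monom)
    have d: "degree ?p < card S"
      unfolding p kn by (intro le_imp_less_Suc degree_diff_le order_trans[OF degree_monom_le]) auto
    have c: "coeff ?p (card S - 1) = 1" unfolding p kn using \<open>n \<ge> 1\<close> kn by simp
    have "g ^ (card S - n) dvd poly ?p x * sgn (\<Prod>y\<in>S-{x}. x - y) * diffprod (S-{x})" if x: "x \<in> S" for x
    proof -
      have "k = card (S-{x})" using x kn Suc.prems by simp
      then have "g ^ (card (S-{x}) - n) dvd diffprod (S-{x})"
        using Suc.prems by (intro Suc.hyps) auto
      moreover have "g dvd poly ?p x"
        using Suc.prems(3)[OF x] by (simp add: poly_monom)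
      ultimately have "g * g ^ (card (S-{x}) - n) dvd (poly ?p x * sgn (\<Prod>y\<in>S-{x}. x - y)) * diffprod (S-{x})"
        by (intro mult_dvd_mono dvd_mult2)
      then show ?thesis using kn \<open>k = _\<close> by (simp add: Suc_diff_le)
    qed
    then show ?thesis
      unfolding diffprod_expand[OF \<open>finite S\<close> d c] by (intro dvd_sum)
  qed simp
qed simp


lemma diffprod_le:
  assumes "finite S" "S \<subseteq> {1..B}" "B \<ge> 1"
  shows "diffprod S \<le> B ^ (card S * card S)"
proof -
  have "(\<Prod>y\<in>{y\<in>S. y < x}. x - y) \<le> B ^ card S" if "x \<in> S" for x
  proof -
    have "(\<Prod>y\<in>{y\<in>S. y < x}. x - y) \<le> (\<Prod>y\<in>{y\<in>S. y < x}. B)"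
    proof (intro prod_mono conjI)
      fix y assume "y \<in> {y\<in>S. y < x}"
      then have "y \<ge> 1" "y < x" "x \<le> B" using assms that by auto
      then show "0 \<le> x - y" "x - y \<le> B" by simp_all
    qed
    also have "\<dots> \<le> B ^ card S"
      using assms by (auto intro!: power_increasing card_mono)
    finally show ?thesis .
  qed
  then have "diffprod S \<le> (\<Prod>x\<in>S. B ^ card S)"
    unfolding diffprod_def by (intro prod_mono) (auto intro!: prod_nonneg)
  then show ?thesis by (simp add: power_mult)
qed

section \<open>Products of nearly coprime divisors\<close>

lemma gcd_mult_dvd_mult_gcd:
  fixes a b c :: "'a::semiring_gcd"
  shows "gcd (a * b) c dvd gcd a c * gcd b c"
proof -
  have "gcd (a * b) c dvd gcd (a * b) (a * c)" by (simp add: dvd_mult)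
  then have "gcd (a * b) c dvd a * gcd b c" by (simp add: gcd_mult_left)
  then have "gcd (a * b) c dvd gcd (a * gcd b c) (c * gcd b c)" by (simp add: dvd_mult2)
  then show ?thesis by (simp add: gcd_mult_right gcd.commute)
qed

lemma gcd_prod_dvd_prod_gcd:
  fixes f :: "'i \<Rightarrow> 'a::semiring_gcd"
  shows "gcd (\<Prod>i\<in>J. f i) c dvd (\<Prod>i\<in>J. gcd (f i) c)"
proof (induction J rule: infinite_finite_induct)
  case (insert i J)
  have "gcd (f i * prod f J) c dvd gcd (f i) c * gcd (prod f J) c"
    by (rule gcd_mult_dvd_mult_gcd)
  also have "\<dots> dvd gcd (f i) c * (\<Prod>i\<in>J. gcd (f i) c)"
    using insert by (intro mult_dvd_mono) auto
  finally show ?case using insert by simp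
qed auto

text \<open>
  Pairwise coprime divisors of \<open>V\<close> have a product that divides \<open>V\<close>; in general one pays for the
  common factor of each pair once. The proof adds the divisors one at a time and uses that
  \<open>lcm P y * gcd P y\<close> and \<open>P * y\<close> agree up to sign, where \<open>gcd P y\<close> divides the product of the
  pairwise gcds.
\<close>

lemma prod_power_dvd:
  fixes x :: "nat \<Rightarrow> int"
  assumes "finite J" "\<And>n. n \<in> J \<Longrightarrow> x n ^ e dvd V"
  shows "(\<Prod>n\<in>J. x n ^ e) dvd V * (\<Prod>n\<in>J. \<Prod>m\<in>{m\<in>J. m < n}. gcd (x m) (x n) ^ e)"
  using assms
proof (induction J rule: finite_linorder_max_induct)
  case (insert b J)
  let ?P = "\<Prod>n\<in>J. x n ^ e"
  let ?G = "\<Prod>n\<in>J. \<Prod>m\<in>{m\<in>J. m < n}. gcd (x m) (x n) ^ e"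
  let ?H = "\<Prod>m\<in>J. gcd (x m) (x b) ^ e"
  have b: "b \<notin> J" using insert by auto
  have "?P dvd V * ?G" "x b ^ e dvd V * ?G" using insert by auto
  then have "lcm ?P (x b ^ e) dvd V * ?G" by simp
  moreover have "gcd ?P (x b ^ e) dvd ?H"
    using gcd_prod_dvd_prod_gcd[of "\<lambda>n. x n ^ e" J "x b ^ e"] by (simp add: gcd_exp)
  ultimately have "lcm ?P (x b ^ e) * gcd ?P (x b ^ e) dvd (V * ?G) * ?H"
    by (rule mult_dvd_mono)
  then have "?P * x b ^ e dvd (V * ?G) * ?H"
    by (simp only: lcm_mult_gcd normalize_mult[symmetric] normalize_dvd_iff)
  moreover have "{m\<in>insert b J. m < n} = {m\<in>J. m < n}" if "n \<in> J" for n
    using insert that by auto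
  moreover have "{m\<in>insert b J. m < b} = J" using insert by auto
  ultimately show ?case using insert b by (simp add: mult_ac)
qed auto

text \<open>
  The Euclidean algorithm on the exponents, through
  \<open>a ^ n - 1 = a ^ (n - m) * (a ^ m - 1) + (a ^ (n - m) - 1)\<close>.
\<close>

lemma gcd_power_minus_one:
  fixes a :: int
  assumes "a \<ge> 1"
  shows "gcd (a ^ m - 1) (a ^ n - 1) = a ^ gcd m n - 1"
proof (induction "m + n" arbitrary: m n rule: less_induct)
  case less
  have step: "gcd (a ^ m - 1) (a ^ n - 1) = a ^ gcd m n - 1"
    if "m \<le> n" "m > 0" "\<And>m' n'. m' + n' < m + n \<Longrightarrow> gcd (a ^ m' - 1) (a ^ n' - 1) = a ^ gcd m' n' - 1" for m n
  proof -
    have "a ^ n - 1 = a ^ (n - m) * (a ^ m - 1) + (a ^ (n - m) - 1)"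
      using that by (simp add: algebra_simps flip: power_add)
    then have "gcd (a ^ m - 1) (a ^ n - 1) = gcd (a ^ m - 1) (a ^ (n - m) - 1)"
      by (simp only: gcd_add_mult)
    also have "\<dots> = a ^ gcd m (n - m) - 1" using that by auto
    also have "gcd m (n - m) = gcd m n" using that(1) by (metis gcd_diff1_nat gcd.commute)
    finally show ?thesis .
  qed
  consider "m = 0" | "n = 0" | "m > 0" "n > 0" "m \<le> n" | "m > 0" "n > 0" "n \<le> m" by linarith
  then show ?case
  proof cases
    case 3 then show ?thesis using step[of m n] less by blast
  next
    case 4 then show ?thesis using step[of n m] less by (metis add.commute gcd.commute)
  qed (use assms in auto)
qed

lemma sum_inverse_le_sqrt: "(\<Sum>d=1..n. 1 / real d) \<le> 2 * sqrt (real n)"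
proof (induction n)
  case (Suc n)
  let ?s = "sqrt (real (Suc n))" and ?r = "sqrt (real n)"
  have "(?s - ?r) * (?s + ?r) = 1" by (simp add: algebra_simps)
  moreover have "?r \<le> ?s" by simp
  moreover have "?s * ?s = real (Suc n)" by simp
  moreover have "1 \<le> ?s" by simp
  ultimately have "1 / real (Suc n) \<le> 2 * (?s - ?r)"
  proof -
    have s: "?s > 0" by simp
    have "1 \<le> (?s - ?r) * (2 * ?s)"
      using \<open>(?s - ?r) * (?s + ?r) = 1\<close> \<open>?r \<le> ?s\<close> mult_left_mono[of "?s + ?r" "2 * ?s" "?s - ?r"] by linarith
    also have "\<dots> \<le> (?s - ?r) * (2 * (?s * ?s))"
    proof (intro mult_left_mono)
      show "?s \<le> ?s * ?s" using mult_left_mono[OF \<open>1 \<le> ?s\<close>, of ?s] s by simp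
    qed (use \<open>?r \<le> ?s\<close> in auto)
    finally show ?thesis by (simp add: field_simps)
  qed
  then show ?case using Suc by simp
qed simp

text \<open>
  The estimate \<open>gcd m n \<le> n - m\<close> only gives the order \<open>Y ^ 3\<close>, which is just too weak for the
  size comparison below. Instead \<open>gcd m n\<close> is at most the sum of all common divisors \<open>d\<close> of
  \<open>m\<close> and \<open>n\<close>. There are \<open>O (Y / d)\<close> multiples of \<open>d\<close> in the interval and hence
  \<open>O ((Y / d) ^ 2)\<close> pairs of them, so that \<open>d\<close> contributes \<open>O (Y ^ 2 / d)\<close>, with a total of
  \<open>Y ^ 2\<close> times a harmonic sum. The bound \<open>2 * sqrt Y\<close> for the harmonic sum is crude but suffices.
\<close>

lemma sum_gcd_pairs_le:
  fixes X Y :: nat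
  defines "I \<equiv> {X<..X+Y}"
  shows "real (\<Sum>n\<in>I. \<Sum>m\<in>{m\<in>I. m < n}. gcd m n) \<le> 6 * real Y ^ 2 * sqrt (real Y)"
proof -
  have fin: "finite I" by (simp add: I_def)
  define P where "P d = {(n, m). n \<in> I \<and> m \<in> I \<and> m < n \<and> d dvd m \<and> d dvd n}" for d
  have finP: "finite (P d)" for d
    by (rule finite_subset[of _ "I \<times> I"]) (auto simp: P_def fin)
  have "(\<Sum>n\<in>I. \<Sum>m\<in>{m\<in>I. m < n}. gcd m n)
      \<le> (\<Sum>n\<in>I. \<Sum>m\<in>{m\<in>I. m < n}. \<Sum>d\<in>{1..Y}. if d dvd m \<and> d dvd n then d else 0)"
  proof (intro sum_mono)
    fix n m assume n: "n \<in> I" and m: "m \<in> {m\<in>I. m < n}"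
    have "gcd m n dvd n - m" by (simp add: dvd_diff_nat)
    then have "gcd m n \<le> n - m" using m by (intro dvd_imp_le) auto
    moreover have "gcd m n > 0" using n by (intro gcd_pos_nat[THEN iffD2]) (auto simp: I_def)
    ultimately have g: "gcd m n \<in> {1..Y}" using n m by (auto simp: I_def Suc_le_eq)
    have "gcd m n = (\<Sum>d\<in>{gcd m n}. if d dvd m \<and> d dvd n then d else 0)" by simp
    also have "\<dots> \<le> (\<Sum>d\<in>{1..Y}. if d dvd m \<and> d dvd n then d else 0)"
      by (rule sum_mono2) (use g in auto)
    finally show "gcd m n \<le> \<dots>" .
  qed
  also have "\<dots> = (\<Sum>(n,m)\<in>(SIGMA n:I. {m\<in>I. m < n}). \<Sum>d\<in>{1..Y}. if d dvd m \<and> d dvd n then d else 0)"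
    by (rule sum.Sigma) (auto simp: fin)
  also have "\<dots> = (\<Sum>d\<in>{1..Y}. \<Sum>(n,m)\<in>(SIGMA n:I. {m\<in>I. m < n}). if d dvd m \<and> d dvd n then d else 0)"
    unfolding case_prod_unfold by (rule sum.swap)
  also have "\<dots> = (\<Sum>d\<in>{1..Y}. d * card (P d))"
  proof (rule sum.cong[OF refl])
    fix d
    have "(\<Sum>(n,m)\<in>(SIGMA n:I. {m\<in>I. m < n}). if d dvd m \<and> d dvd n then d else 0) = (\<Sum>_\<in>P d. d)"
      by (intro sum.mono_neutral_cong_right) (auto simp: P_def fin split: if_splits)
    then show "(\<Sum>(n,m)\<in>(SIGMA n:I. {m\<in>I. m < n}). if d dvd m \<and> d dvd n then d else 0) = d * card (P d)"
      by simp
  qed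
  finally have *: "(\<Sum>n\<in>I. \<Sum>m\<in>{m\<in>I. m < n}. gcd m n) \<le> (\<Sum>d\<in>{1..Y}. d * card (P d))" .
  have "real (d * card (P d)) \<le> 3 * real Y ^ 2 * (1 / real d)" if d: "d \<in> {1..Y}" for d
  proof -
    \<comment> \<open>A pair is determined by its smaller quotient and the difference of the quotients.\<close>
    let ?T = "{X div d..(X + Y) div d} \<times> {1..Y div d}"
    have "card (P d) \<le> card ?T"
    proof (rule card_inj_on_le)
      show "inj_on (\<lambda>(n, m). (m div d, (n - m) div d)) (P d)"
      proof (rule inj_onI, clarify)
        fix n m n' m'
        assume A: "(n, m) \<in> P d" "(n', m') \<in> P d" "m div d = m' div d" "(n - m) div d = (n' - m') div d"
        have "m = m'" using A(1-3) by (auto simp: P_def dvd_div_eq_iff)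
        moreover have "d dvd n - m" "d dvd n' - m'" using A by (auto simp: P_def dvd_diff_nat)
        then have "n - m = n' - m'" using A(4) by (metis dvd_div_mult_self)
        ultimately show "n = n' \<and> m = m'" using A(1,2) by (auto simp: P_def)
      qed
      show "(\<lambda>(n, m). (m div d, (n - m) div d)) ` P d \<subseteq> ?T"
      proof (clarify)
        fix n m assume A: "(n, m) \<in> P d"
        have "d dvd n - m" "n - m > 0" using A by (auto simp: P_def dvd_diff_nat)
        then have "d \<le> n - m" by (intro dvd_imp_le)
        then have "(n - m) div d \<ge> 1" using d by (simp add: Suc_le_eq div_greater_zero_iff)
        moreover have "n - m \<le> Y" using A by (auto simp: P_def I_def)
        ultimately show "m div d \<in> {X div d..(X + Y) div d} \<and> (n - m) div d \<in> {1..Y div d}"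
          using A by (auto simp: P_def I_def intro!: div_le_mono)
      qed
    qed auto
    also have "card ?T = ((X + Y) div d - X div d + 1) * (Y div d)"
      by (simp add: card_cartesian_product Suc_diff_le div_le_mono)
    finally have c: "real (card (P d)) \<le> real ((X + Y) div d - X div d + 1) * real (Y div d)"
      by (metis of_nat_le_iff of_nat_mult)
    have yd: "real (Y div d) \<le> real Y / real d" by (rule of_nat_div_le_of_nat)
    have "(X + Y) div d \<le> X div d + Y div d + 1"
    proof -
      have "X < (X div d + 1) * d" "Y < (Y div d + 1) * d"
        using d dividend_less_times_div[of d X] dividend_less_times_div[of d Y]
        by (auto simp: algebra_simps)
      then have "X + Y < (X div d + Y div d + 2) * d" by (simp add: algebra_simps)
      then have "(X + Y) div d < X div d + Y div d + 2" using d by (simp add: less_mult_imp_div_less)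
      then show ?thesis by simp
    qed
    then have "real ((X + Y) div d - X div d + 1) \<le> real (Y div d) + 2" by linarith
    also have "\<dots> \<le> 3 * (real Y / real d)"
      using yd d by (simp add: field_simps)
    finally have "real ((X + Y) div d - X div d + 1) * real (Y div d) \<le> 3 * (real Y / real d) * (real Y / real d)"
      using yd by (intro mult_mono) auto
    with c have "real d * real (card (P d)) \<le> real d * (3 * (real Y / real d) * (real Y / real d))"
      by (intro mult_left_mono) auto
    also have "\<dots> = 3 * real Y ^ 2 * (1 / real d)" using d by (simp add: power2_eq_square)
    finally show ?thesis by simp
  qed
  then have "(\<Sum>d\<in>{1..Y}. real (d * card (P d))) \<le> (\<Sum>d\<in>{1..Y}. 3 * real Y ^ 2 * (1 / real d))"
    by (rule sum_mono)
  also have "\<dots> = 3 * real Y ^ 2 * (\<Sum>d=1..Y. 1 / real d)"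
    by (simp only: sum_distrib_left)
  also have "\<dots> \<le> 3 * real Y ^ 2 * (2 * sqrt (real Y))"
    by (intro mult_left_mono sum_inverse_le_sqrt) auto
  finally have "real (\<Sum>d\<in>{1..Y}. d * card (P d)) \<le> 6 * real Y ^ 2 * sqrt (real Y)" by simp
  then show ?thesis using * by (meson of_nat_le_iff order_trans)
qed


section \<open>Long runs of small gcds\<close>

lemma gcd_seq_pos:
  assumes "a \<ge> 2" "n \<ge> 1"
  shows "gcd_seq a b n > 0"
proof -
  have "a ^ n \<ge> a ^ 1" using assms by (intro power_increasing) auto
  then show ?thesis using assms by (auto simp: gcd_seq_def)
qed

lemma monomials_inj:
  assumes "a \<ge> 2" "b \<ge> 2" "\<not> mult_dependent a b"
  shows "inj (\<lambda>(i, j). a ^ i * b ^ j)"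
proof (rule injI, clarify)
  fix i j i' j' :: nat
  assume eq: "a ^ i * b ^ j = a ^ i' * b ^ j'"
  have less: False if "i < i'" "a ^ i * b ^ j = a ^ i' * b ^ j'" for i j i' j'
  proof -
    have "a ^ i * b ^ j = a ^ i * (a ^ (i' - i) * b ^ j')"
      using that by (simp flip: power_add mult.assoc)
    then have *: "b ^ j = a ^ (i' - i) * b ^ j'" using assms by simp
    have gt: "a ^ (i' - i) > 1" using that assms by (intro one_less_power) auto
    have "b ^ j' < b ^ j"
      using mult_strict_right_mono[OF gt, of "b ^ j'"] assms unfolding * by simp
    then have j: "j' < j" using assms by (simp add: power_strict_increasing_iff)
    then have "b ^ j = b ^ (j - j') * b ^ j'" by (simp flip: power_add)
    with * have "b ^ (j - j') = a ^ (i' - i)" using assms by simp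
    then show False using assms(3) that j
      unfolding mult_dependent_def by (metis Suc_leI One_nat_def zero_less_diff)
  qed
  have "i = i'" using less[of i i' j j'] less[of i' i j' j] eq by (metis linorder_neqE_nat)
  then show "i = i' \<and> j = j'" using eq assms by (simp add: power_inject_exp)
qed

text \<open>
  The exponents are chosen so that the two error terms have the same order. For indices near
  \<open>X = t ^ 10\<close> the Vandermonde product of the \<open>R ^ 2\<close> monomials with exponents below \<open>R = 2 * t ^ 5\<close>
  allows a total of order \<open>X * R = t ^ 15\<close>, up to a constant. For an interval of length \<open>Y = t ^ 6\<close>
  the common factors cost \<open>Y ^ 2 * sqrt Y = t ^ 15\<close>. If a positive proportion of the terms in the
  interval were exponentially large, the sum would be of order \<open>Y * X = t ^ 16\<close>.
\<close>

lemma sum_ln_gcd_seq_le: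
  fixes a b :: int and t :: nat
  assumes ab: "a \<ge> 2" "b \<ge> 2" "\<not> mult_dependent a b" and t: "t \<ge> 1"
    and J: "J \<subseteq> {t^10<..t^10 + t^6}"
  shows "(\<Sum>n\<in>J. ln (gcd_seq a b n)) \<le> (16 * ln (real_of_int (a * b)) + 6 * ln (real_of_int a)) * real t ^ 15"
proof -
  define R where "R = 2 * t ^ 5"
  define e where "e = 2 * t ^ 10"
  \<comment> \<open>\<open>S\<close> has \<open>4 * t ^ 10\<close> elements and every index is at most \<open>2 * t ^ 10\<close>, so that the power \<open>e\<close> is available for all indices at once.\<close>
  define S where "S = (\<lambda>(i, j). a ^ i * b ^ j) ` ({..<R} \<times> {..<R})"
  define B where "B = (a * b) ^ R"
  let ?g = "gcd_seq a b"
  have t610: "t ^ 6 \<le> t ^ 10" using t by (intro power_increasing) auto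
  have fJ: "finite J" using J by (rule finite_subset) auto
  have gpos: "?g n > 0" if "n \<in> J" for n
    using that J ab by (intro gcd_seq_pos) auto
  have fS: "finite S" by (simp add: S_def)
  have cS: "card S = 4 * t ^ 10"
  proof -
    have "card S = card ({..<R} \<times> {..<R})"
      unfolding S_def by (intro card_image inj_on_subset[OF monomials_inj[OF ab]]) auto
    then show ?thesis by (simp add: R_def card_cartesian_product flip: power_add)
  qed
  have "a * b \<ge> 1" using mult_mono[of 1 a 1 b] ab by simp
  then have B1: "B \<ge> 1" by (simp add: B_def)
  have SB: "S \<subseteq> {1..B}"
  proof
    fix x assume "x \<in> S"
    then obtain i j where ij: "i < R" "j < R" "x = a ^ i * b ^ j" by (auto simp: S_def)
    have "a ^ i * b ^ j \<le> a ^ R * b ^ R"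
      using ij ab by (intro mult_mono power_increasing) auto
    moreover have "0 < a ^ i * b ^ j" using ab by simp
    ultimately show "x \<in> {1..B}" by (simp add: ij B_def power_mult_distrib)
  qed
  have V: "?g n ^ e dvd diffprod S" if n: "n \<in> J" for n
  proof -
    have n1: "n \<ge> 1" "n \<le> 2 * t ^ 10" using n J t610 by auto
    have "?g n ^ (card S - n) dvd diffprod S"
    proof (rule power_dvd_diffprod[OF fS n1(1)])
      fix x assume "x \<in> S"
      then obtain i j where "x = a ^ i * b ^ j" by (auto simp: S_def)
      then have x: "x ^ n - 1 = (a ^ n) ^ i * ((b ^ n) ^ j - 1) + ((a ^ n) ^ i - 1)"
        by (simp add: algebra_simps power_mult_distrib flip: power_mult)
      have "?g n dvd a ^ n - 1" "?g n dvd b ^ n - 1" by (simp_all add: gcd_seq_def)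
      moreover have "y - 1 dvd y ^ k - 1" for y :: int and k
        by (metis dvd_triv_left power_diff_1_eq)
      ultimately show "?g n dvd x ^ n - 1" unfolding x
        by (meson dvd_add dvd_mult dvd_trans)
    qed
    moreover have "?g n ^ e dvd ?g n ^ (card S - n)"
      using n1 by (intro le_imp_power_dvd) (simp add: cS e_def)
    ultimately show ?thesis by (rule dvd_trans[rotated])
  qed
  let ?pairs = "\<lambda>f. \<Prod>n\<in>J. \<Prod>m\<in>{m\<in>J. m < n}. f m n"
  let ?G = "\<Sum>n\<in>J. \<Sum>m\<in>{m\<in>J. m < n}. gcd m n"
  have gg: "0 < gcd (?g m) (?g n) \<and> gcd (?g m) (?g n) \<le> a ^ gcd m n" if "n \<in> J" for m n
  proof -
    have "gcd m n \<ge> 1" using that J by (auto simp: Suc_le_eq)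
    then have "a ^ gcd m n - 1 > 0" using ab by (simp add: one_less_power Suc_le_eq)
    moreover have "gcd (?g m) (?g n) dvd gcd (a ^ m - 1) (a ^ n - 1)"
      by (intro gcd_mono) (auto simp: gcd_seq_def)
    then have "gcd (?g m) (?g n) dvd a ^ gcd m n - 1" using ab by (simp add: gcd_power_minus_one)
    ultimately have "gcd (?g m) (?g n) \<le> a ^ gcd m n - 1" by (rule zdvd_imp_le[rotated])
    then show ?thesis using gpos[OF that] by simp
  qed
  have "(\<Prod>n\<in>J. ?g n ^ e) dvd diffprod S * ?pairs (\<lambda>m n. gcd (?g m) (?g n) ^ e)"
    using fJ V by (rule prod_power_dvd)
  then have "(\<Prod>n\<in>J. ?g n ^ e) \<le> diffprod S * ?pairs (\<lambda>m n. gcd (?g m) (?g n) ^ e)"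
    using gg by (intro zdvd_imp_le mult_pos_pos diffprod_pos prod_pos) auto
  also have "\<dots> \<le> B ^ (card S * card S) * ?pairs (\<lambda>m n. (a ^ gcd m n) ^ e)"
  proof (intro mult_mono diffprod_le fS SB B1)
    show "?pairs (\<lambda>m n. gcd (?g m) (?g n) ^ e) \<le> ?pairs (\<lambda>m n. (a ^ gcd m n) ^ e)"
      using gg by (intro prod_mono conjI prod_nonneg power_mono) auto
    show "?pairs (\<lambda>m n. gcd (?g m) (?g n) ^ e) \<ge> 0" by (intro prod_nonneg) auto
  qed (use B1 in auto)
  also have "?pairs (\<lambda>m n. (a ^ gcd m n) ^ e) = a ^ (e * ?G)"
    by (simp add: power_sum sum_distrib_left mult.commute flip: power_mult)
  also have "B ^ (card S * card S) = (a * b) ^ (e * (16 * t ^ 15))"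
    by (simp add: B_def cS e_def R_def flip: power_mult power_add)
  finally have le: "(\<Prod>n\<in>J. ?g n ^ e) \<le> (a * b) ^ (e * (16 * t ^ 15)) * a ^ (e * ?G)" .
  have ab0: "real_of_int a > 0" "real_of_int b > 0" "real_of_int (a * b) > 0" using ab by auto
  have "real_of_int (\<Prod>n\<in>J. ?g n ^ e) \<le> real_of_int ((a * b) ^ (e * (16 * t ^ 15)) * a ^ (e * ?G))"
    using le by (simp only: of_int_le_iff)
  then have "ln (\<Prod>n\<in>J. real_of_int (?g n) ^ e) \<le> ln (real_of_int (a * b) ^ (e * (16 * t ^ 15)) * real_of_int a ^ (e * ?G))"
    using gpos ab0 by (subst ln_le_cancel_iff) (auto intro!: prod_pos zero_less_power)
  also have "\<dots> = real e * (real (16 * t ^ 15) * ln (real_of_int (a * b)) + real ?G * ln a)"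
    using ab0 by (subst ln_mult_pos) (simp_all add: ln_realpow algebra_simps del: of_int_mult)
  also have "ln (\<Prod>n\<in>J. real_of_int (?g n) ^ e) = (\<Sum>n\<in>J. ln (real_of_int (?g n) ^ e))"
    using gpos by (intro ln_prod fJ) (auto simp: less_imp_neq[symmetric] dest: gpos)
  also have "\<dots> = real e * (\<Sum>n\<in>J. ln (?g n))"
    using gpos by (simp add: ln_realpow sum_distrib_left)
  finally have "(\<Sum>n\<in>J. ln (?g n)) \<le> real (16 * t ^ 15) * ln (real_of_int (a * b)) + real ?G * ln a"
    using t by (simp add: e_def)
  moreover have "real ?G \<le> 6 * real t ^ 15"
  proof -
    let ?I = "{t^10<..t^10 + t^6}"
    have "?G \<le> (\<Sum>n\<in>?I. \<Sum>m\<in>{m\<in>?I. m < n}. gcd m n)"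
      using J by (intro order_trans[OF sum_mono sum_mono2] sum_mono2) auto
    then have "real ?G \<le> 6 * real (t ^ 6) ^ 2 * sqrt (real (t ^ 6))"
      using sum_gcd_pairs_le[of "t^10" "t^6"] by (meson of_nat_le_iff order_trans)
    also have "sqrt (real (t ^ 6)) = real t ^ 3"
      by (rule real_sqrt_unique) (simp_all flip: power_mult)
    finally show ?thesis by (simp add: mult.assoc flip: power_mult power_add)
  qed
  moreover have "ln (real_of_int a) \<ge> 0" using ab by simp
  ultimately have "(\<Sum>n\<in>J. ln (?g n)) \<le> real (16 * t ^ 15) * ln (real_of_int (a * b)) + 6 * real t ^ 15 * ln a"
    by (meson add_left_mono mult_right_mono order_trans)
  then show ?thesis by (simp add: algebra_simps)
qed

text \<open>
  Otherwise every window of \<open>L\<close> consecutive indices contains one with a large gcd. Picking one index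
  in each of the disjoint windows that fit into the interval of length \<open>t ^ 6\<close> above \<open>t ^ 10\<close> gives
  a sum of logarithms of order \<open>t ^ 16\<close>, which exceeds the bound of order \<open>t ^ 15\<close> for large \<open>t\<close>.
\<close>

lemma exists_run_of_small_gcds:
  fixes a b :: int and \<delta> :: real
  assumes ab: "a \<ge> 2" "b \<ge> 2" "\<not> mult_dependent a b" and \<delta>: "\<delta> > 0" and L: "L \<ge> 1"
  shows "\<exists>n\<ge>n0. \<forall>i<L. ln (gcd_seq a b (n + i)) < \<delta> * n"
proof (rule ccontr)
  assume "\<not> ?thesis"
  then have "\<forall>n\<ge>n0. \<exists>i<L. ln (gcd_seq a b (n + i)) \<ge> \<delta> * n" by (auto simp: not_less)
  then obtain h where h: "\<And>n. n \<ge> n0 \<Longrightarrow> h n < L \<and> ln (gcd_seq a b (n + h n)) \<ge> \<delta> * n" by metis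
  define C where "C = 16 * ln (real_of_int (a * b)) + 6 * ln (real_of_int a)"
  obtain t0 :: nat where t0: "real t0 > 2 * L * C / \<delta>" using reals_Archimedean2 by blast
  define t where "t = t0 + n0 + 2 * L"
  have t: "t \<ge> 1" "t \<ge> n0" "t \<ge> 2 * L" "real t > 2 * L * C / \<delta>" using t0 L by (auto simp: t_def)
  have tp: "t \<le> t ^ 6" "t \<le> t ^ 10" using t(1) by (auto intro: self_le_power)
  define Q where "Q = t ^ 6 div L"
  \<comment> \<open>The index picked from the window number \<open>q\<close>.\<close>
  define f where "f q = t ^ 10 + 1 + q * L + h (t ^ 10 + 1 + q * L)" for q
  have hf: "h (t ^ 10 + 1 + q * L) < L" "ln (gcd_seq a b (f q)) \<ge> \<delta> * (t ^ 10 + 1 + q * L)" for q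
    using h[of "t ^ 10 + 1 + q * L"] t tp unfolding f_def by auto
  have inj: "inj_on f {..<Q}"
  proof -
    have "f q < f (Suc q)" for q using hf(1)[of q] by (simp add: f_def)
    then have "strict_mono f" by (simp add: strict_mono_Suc_iff)
    then show ?thesis by (auto intro: inj_onI simp: strict_mono_eq)
  qed
  have sub: "f ` {..<Q} \<subseteq> {t^10<..t^10 + t^6}"
  proof (rule image_subsetI)
    fix q assume "q \<in> {..<Q}"
    then have "(q + 1) * L \<le> Q * L" by (intro mult_le_mono) auto
    also have "\<dots> \<le> t ^ 6" by (simp add: Q_def)
    finally show "f q \<in> {t^10<..t^10 + t^6}" using hf(1)[of q] by (simp add: f_def)
  qed
  have "real Q * (\<delta> * real t ^ 10) = (\<Sum>q<Q. \<delta> * real t ^ 10)" by simp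
  also have "\<dots> \<le> (\<Sum>q<Q. ln (gcd_seq a b (f q)))"
  proof (rule sum_mono)
    fix q
    have "\<delta> * real t ^ 10 \<le> \<delta> * (t ^ 10 + 1 + q * L)" using \<delta> by (intro mult_left_mono) auto
    then show "\<delta> * real t ^ 10 \<le> ln (gcd_seq a b (f q))" using hf(2)[of q] by linarith
  qed
  also have "\<dots> = (\<Sum>n\<in>f ` {..<Q}. ln (gcd_seq a b n))" by (simp add: sum.reindex[OF inj])
  also have "\<dots> \<le> C * real t ^ 15" unfolding C_def by (rule sum_ln_gcd_seq_le[OF ab t(1) sub])
  finally have 1: "real Q * (\<delta> * real t ^ 10) \<le> C * real t ^ 15" .
  have "real t ^ 6 \<le> 2 * L * real Q"
  proof -
    have "t ^ 6 < L * Q + L" unfolding Q_def using L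
      by (metis add.commute add_strict_left_mono less_le_trans mod_less_divisor mult_div_mod_eq zero_less_one)
    moreover have "2 * L \<le> t ^ 6" using t tp by linarith
    ultimately have "t ^ 6 \<le> 2 * L * Q" by linarith
    then have "real (t ^ 6) \<le> real (2 * L * Q)" by (simp only: of_nat_le_iff)
    then show ?thesis by simp
  qed
  then have "real t ^ 6 * (\<delta> * real t ^ 10) \<le> 2 * L * real Q * (\<delta> * real t ^ 10)"
    using \<delta> by (intro mult_right_mono) auto
  also have "\<dots> \<le> 2 * L * (C * real t ^ 15)"
    using mult_left_mono[OF 1, of "2 * real L"] by (simp add: mult_ac)
  finally have "(\<delta> * t) * real t ^ 15 \<le> (2 * L * C) * real t ^ 15"
    by (simp add: mult_ac flip: power_add power_Suc)
  then have "\<delta> * t \<le> 2 * L * C" using t(1) by simp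
  then show False using t(4) \<delta> by (simp add: field_simps)
qed


section \<open>Polynomials in the shift acting on sequences\<close>

text \<open>
  With \<open>E\<close> the shift \<open>u \<mapsto> (\<lambda>n. u (n + 1))\<close>, this is \<open>p E\<close> applied to \<open>u\<close>. A linear recurrence says
  that a monic polynomial in \<open>E\<close> annihilates the sequence.
\<close>

definition shift_op :: "'a::comm_ring_1 poly \<Rightarrow> (nat \<Rightarrow> 'a) \<Rightarrow> nat \<Rightarrow> 'a" where
  "shift_op p u n = (\<Sum>i\<le>degree p. coeff p i * u (n + i))"

lemma shift_op_altdef:
  "degree p \<le> m \<Longrightarrow> shift_op p u n = (\<Sum>i\<le>m. coeff p i * u (n + i))"
  unfolding shift_op_def by (intro sum.mono_neutral_left) (auto simp: coeff_eq_0)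

lemma shift_op_0 [simp]: "shift_op 0 u n = 0"
  by (simp add: shift_op_def)

lemma shift_op_pCons [simp]: "shift_op (pCons c p) u n = c * u n + shift_op p u (Suc n)"
proof -
  have "shift_op (pCons c p) u n = (\<Sum>i\<le>Suc (degree p). coeff (pCons c p) i * u (n + i))"
    by (intro shift_op_altdef degree_pCons_le)
  then show ?thesis by (simp only: sum.atMost_Suc_shift) (simp add: shift_op_def)
qed

lemma shift_op_add: "shift_op (p + q) u n = shift_op p u n + shift_op q u n"
  using shift_op_altdef[of "p + q" "max (degree p) (degree q)" u n]
    shift_op_altdef[of p "max (degree p) (degree q)" u n]
    shift_op_altdef[of q "max (degree p) (degree q)" u n]
  by (simp add: degree_add_le_max sum.distrib distrib_right)

lemma shift_op_smult: "shift_op (smult c p) u n = c * shift_op p u n"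
  using shift_op_altdef[of "smult c p" "degree p" u n]
  by (simp add: shift_op_def sum_distrib_left mult.assoc degree_smult_le)

lemma shift_op_diff: "shift_op (p - q) u n = shift_op p u n - shift_op q u n"
  using shift_op_add[of p "smult (-1) q" u n] shift_op_smult[of "-1" q u n] by simp

lemma shift_op_sum: "shift_op (\<Sum>i\<in>I. p i) u n = (\<Sum>i\<in>I. shift_op (p i) u n)"
  by (induction I rule: infinite_finite_induct) (simp_all add: shift_op_add)

lemma shift_op_mult: "shift_op (p * q) u n = shift_op p (shift_op q u) n"
  by (induction p arbitrary: n) (simp_all add: shift_op_add shift_op_smult)

lemma shift_op_monom: "shift_op (monom c m) u n = c * u (n + m)"
  by (induction m arbitrary: n) (simp_all add: monom_0 monom_Suc)

lemma shift_op_1 [simp]: "shift_op 1 u n = u n"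
  using shift_op_monom[of 1 0 u n] by simp

lemma shift_op_eq_0: "(\<And>n. n \<ge> n0 \<Longrightarrow> u n = 0) \<Longrightarrow> n \<ge> n0 \<Longrightarrow> shift_op p u n = 0"
  by (simp add: shift_op_def)

lemma eventually_shift_op_eq_0:
  assumes "\<forall>\<^sub>F n in sequentially. u n = 0"
  shows "\<forall>\<^sub>F n in sequentially. shift_op p u n = 0"
  using assms unfolding eventually_sequentially by (meson shift_op_eq_0)

text \<open>
  Besides ring homomorphisms \<open>h\<close>, this covers maps that are linear only over the ring in which the
  sequence takes its values, such as the projection in \<open>rational_projection\<close> below.
\<close>

lemma shift_op_map_poly:
  assumes "h 0 = 0" "\<And>x y. h (x + y) = h x + h y" "\<And>x n. h (x * u n) = h x * v n"
  shows "shift_op (map_poly h p) v n = h (shift_op p u n)"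
  by (induction p arbitrary: n) (simp_all add: assms map_poly_pCons)

lemma map_poly_mult_hom:
  fixes h :: "'a::comm_ring_1 \<Rightarrow> 'b::comm_ring_1"
  assumes "h 0 = 0" "\<And>x y. h (x + y) = h x + h y" "\<And>x y. h (x * y) = h x * h y"
  shows "map_poly h (p * q) = map_poly h p * map_poly h q"
proof (induction p)
  case (pCons c p)
  have "map_poly h (x + y) = map_poly h x + map_poly h y" for x y
    by (intro poly_eqI) (simp add: coeff_map_poly assms)
  then show ?case using pCons assms by (simp add: map_poly_pCons map_poly_smult)
qed simp

lemma map_poly_of_rat_mult:
  "map_poly of_rat (p * q) = (map_poly of_rat p * map_poly of_rat q :: 'a::field_char_0 poly)"
  by (rule map_poly_mult_hom) (simp_all add: of_rat_add of_rat_mult)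

lemma map_poly_of_rat_pderiv:
  "map_poly of_rat (pderiv p) = (pderiv (map_poly of_rat p) :: 'a::field_char_0 poly)"
  by (intro poly_eqI) (simp add: coeff_map_poly coeff_pderiv of_rat_mult of_rat_add)

lemma clear_denominators:
  fixes p :: "rat poly"
  shows "\<exists>k P. k \<noteq> 0 \<and> map_poly of_int P = smult (of_int k) p"
proof (induction p)
  case 0
  show ?case by (intro exI[of _ 1] exI[of _ 0]) simp
next
  case (pCons c p)
  then obtain k P where k: "k \<noteq> 0" "map_poly of_int P = smult (of_int k) p" by auto
  obtain x y where c: "c = of_int x / of_int y" "y \<noteq> 0"
    by (metis quotient_of_div quotient_of_denom_pos prod.collapse less_irrefl)
  have "map_poly of_int (smult y P) = smult (of_int y) (map_poly of_int P :: rat poly)"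
    by (rule map_poly_smult) simp_all
  then have "map_poly of_int (pCons (x * k) (smult y P)) = smult (of_int (k * y)) (pCons c p)"
    using c k by (simp add: map_poly_pCons mult.commute)
  then show ?case using k c by (metis mult_eq_0_iff)
qed

section \<open>Integer recurrences of slow growth\<close>

lemma geometric_of_shift_op:
  assumes "\<And>n. n \<ge> n0 \<Longrightarrow> shift_op [:- z, 1:] w n = 0"
  shows "w (n0 + k) = z ^ k * w n0"
proof (induction k)
  case (Suc k)
  have "w (Suc (n0 + k)) = z * w (n0 + k)" using assms[of "n0 + k"] by simp
  then show ?case using Suc by simp
qed simp

text \<open>
  Interpolating the constant \<open>1\<close> at the roots of \<open>p\<close> writes \<open>v\<close> as a combination of sequences, each
  of which is eventually annihilated by a single linear factor \<open>[:- z, 1:]\<close> and so is eventually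
  geometric with ratio \<open>z\<close> of absolute value at most one.
\<close>

lemma bounded_if_simple_roots:
  fixes v :: "nat \<Rightarrow> complex"
  assumes p: "rsquarefree p" and roots: "\<And>z. poly p z = 0 \<Longrightarrow> norm z \<le> 1"
    and v: "\<forall>\<^sub>F n in sequentially. shift_op p v n = 0"
  shows "\<exists>B. \<forall>\<^sub>F n in sequentially. norm (v n) \<le> B"
proof -
  define Z where "Z = {z. poly p z = 0}"
  define c where "c = lead_coeff p"
  have p0: "p \<noteq> 0" using p by (simp add: rsquarefree_def)
  then have c: "c \<noteq> 0" by (simp add: c_def)
  have fin: "finite Z" unfolding Z_def using p0 by (rule poly_roots_finite)
  have dec: "smult c (\<Prod>z\<in>Z. [:-z, 1:]) = p"
    unfolding c_def Z_def by (rule complex_poly_decompose_rsquarefree[OF p])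
  obtain n0 where n0: "\<And>n. n \<ge> n0 \<Longrightarrow> shift_op p v n = 0"
    using v by (auto simp: eventually_sequentially)
  have prod0: "shift_op (\<Prod>z\<in>Z. [:-z, 1:]) v n = 0" if "n \<ge> n0" for n
    using n0[OF that] c unfolding dec[symmetric] by (simp add: shift_op_smult)
  show ?thesis
  proof (cases "Z = {}")
    case True
    then have "norm (v n) \<le> 0" if "n \<ge> n0" for n using prod0[OF that] by simp
    then show ?thesis by (intro exI[of _ 0]) (auto simp: eventually_sequentially)
  next
    case False
    define e where "e z = 1 / (\<Prod>j\<in>Z-{z}. z - j)" for z
    define w where "w z = shift_op (\<Prod>j\<in>Z-{z}. [:- j, 1:]) v" for z
    have "(1 :: complex poly) = (\<Sum>z\<in>Z. smult (e z) (\<Prod>j\<in>Z-{z}. [:- j, 1:]))"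
      using lagrange_interpolation[of Z "\<lambda>z. z" 1] fin False
      by (simp add: e_def inj_on_def card_gt_0_iff)
    then have "shift_op 1 v n = shift_op (\<Sum>z\<in>Z. smult (e z) (\<Prod>j\<in>Z-{z}. [:- j, 1:])) v n" for n
      by simp
    then have vw: "v n = (\<Sum>z\<in>Z. e z * w z n)" for n
      by (simp add: shift_op_sum shift_op_smult w_def)
    have w: "w z (n0 + k) = z ^ k * w z n0" if z: "z \<in> Z" for z k
    proof (rule geometric_of_shift_op)
      fix n assume "n \<ge> n0"
      have "(\<Prod>j\<in>Z. [:-j, 1:]) = [:-z, 1:] * (\<Prod>j\<in>Z-{z}. [:-j, 1:])"
        using fin z by (rule prod.remove)
      then show "shift_op [:- z, 1:] (w z) n = 0"
        using prod0[OF \<open>n \<ge> n0\<close>] unfolding w_def by (simp only: shift_op_mult)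
    qed
    have "norm (v n) \<le> (\<Sum>z\<in>Z. norm (e z) * norm (w z n0))" if n: "n \<ge> n0" for n
    proof -
      obtain k where k: "n = n0 + k" using n le_Suc_ex by blast
      show ?thesis unfolding vw
      proof (rule sum_norm_le)
        fix z assume z: "z \<in> Z"
        then have "norm z ^ k \<le> 1" using roots by (intro power_le_one) (auto simp: Z_def)
        then have "norm z ^ k * norm (w z n0) \<le> 1 * norm (w z n0)" by (intro mult_right_mono) auto
        then show "norm (e z * w z n) \<le> norm (e z) * norm (w z n0)"
          unfolding k w[OF z] by (simp add: norm_mult norm_power mult_left_mono)
      qed
    qed
    then show ?thesis by (auto simp: eventually_sequentially)
  qed
qed

text \<open>
  Only finitely many blocks of \<open>degree p\<close> consecutive values are possible, so some block recurs, and a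
  block determines all later values because \<open>p\<close> has a nonzero leading coefficient.
\<close>

lemma eventually_periodic_if_bounded:
  fixes v :: "nat \<Rightarrow> int" and p :: "rat poly"
  assumes "p \<noteq> 0" and rec: "\<forall>\<^sub>F n in sequentially. shift_op p (\<lambda>n. of_int (v n)) n = 0"
    and bound: "\<forall>\<^sub>F n in sequentially. \<bar>v n\<bar> \<le> B"
  shows "\<exists>M\<ge>1. \<forall>\<^sub>F n in sequentially. v (n + M) = v n"
proof -
  define m where "m = degree p"
  obtain n0 where n0: "\<And>n. n \<ge> n0 \<Longrightarrow> shift_op p (\<lambda>n. of_int (v n)) n = 0 \<and> \<bar>v n\<bar> \<le> B"
    using eventually_conj[OF rec bound] by (auto simp: eventually_sequentially)
  define f where "f n = map v [n..<n + m]" for n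
  have "f ` {n0..} \<subseteq> {xs. set xs \<subseteq> {-B..B} \<and> length xs = m}"
    using n0 by (auto simp: f_def abs_le_iff) (metis minus_le_iff order_trans)+
  then have "finite (f ` {n0..})"
    by (rule finite_subset) (intro finite_lists_length_eq finite_atLeastAtMost_int)
  then have "\<not> inj_on f {n0..}" using infinite_Ici finite_imageD by blast
  then obtain i j where ij: "n0 \<le> i" "i < j" "f i = f j"
    unfolding inj_on_def by (metis atLeast_iff linorder_neqE_nat)
  have eq: "v (i + k) = v (j + k)" for k
  proof (induction k rule: less_induct)
    case (less k)
    show ?case
    proof (cases "k < m")
      case True
      then show ?thesis using arg_cong[OF ij(3), of "\<lambda>xs. xs ! k"] by (simp add: f_def)
    next
      case False
      define l where "l = k - m"
      have sum: "(\<Sum>r<m. coeff p r * of_int (v (i + l + r))) = (\<Sum>r<m. coeff p r * of_int (v (j + l + r)))"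
      proof (rule sum.cong[OF refl])
        fix r assume "r \<in> {..<m}"
        then have "l + r < k" using False by (simp add: l_def)
        then show "coeff p r * of_int (v (i + l + r)) = coeff p r * of_int (v (j + l + r))"
          using less[of "l + r"] by (simp add: add.assoc)
      qed
      have step: "lead_coeff p * of_int (v (x + l + m)) = - (\<Sum>r<m. coeff p r * of_int (v (x + l + r)))" if "x \<ge> n0" for x
        using n0[of "x + l"] that unfolding shift_op_def m_def[symmetric] by (simp add: lessThan_Suc_atMost[symmetric] eq_neg_iff_add_eq_0 add.commute)
      have "lead_coeff p * of_int (v (i + l + m)) = lead_coeff p * of_int (v (j + l + m))"
        using step[of i] step[of j] ij sum by simp
      then have "v (i + l + m) = v (j + l + m)" using \<open>p \<noteq> 0\<close> by simp
      then show ?thesis using False by (simp add: l_def)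
    qed
  qed
  have "v (n + (j - i)) = v n" if "n \<ge> i" for n
    using eq[of "n - i"] that ij by (simp add: add.commute)
  then show ?thesis using ij by (intro exI[of _ "j - i"]) (auto simp: eventually_sequentially)
qed

text \<open>
  The coordinate of \<open>1\<close> in a basis of the complex numbers over the rationals that contains \<open>1\<close>. Applied
  to the coefficients of a complex polynomial that annihilates a rational sequence, it yields a rational
  polynomial that annihilates the same sequence. So complex polynomials annihilating such a sequence are
  no shorter than rational ones.
\<close>

lemma rational_projection:
  "\<exists>\<phi> :: complex \<Rightarrow> rat. (\<forall>x y. \<phi> (x + y) = \<phi> x + \<phi> y) \<and> (\<forall>x q. \<phi> (x * of_rat q) = \<phi> x * q) \<and> \<phi> 1 = 1"
proof -
  interpret V: vector_space "\<lambda>(q::rat) (z::complex). of_rat q * z"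
    by unfold_locales (simp_all add: algebra_simps of_rat_add of_rat_mult)
  have ind: "V.independent {1}" by (simp add: V.dependent_single)
  define E where "E = V.extend_basis {1}"
  have E: "V.independent E" "V.span E = UNIV" "1 \<in> E"
    using V.independent_extend_basis[OF ind] V.span_extend_basis[OF ind] V.extend_basis_superset[OF ind]
    by (auto simp: E_def)
  show ?thesis
    using E by (intro exI[of _ "\<lambda>z. V.representation E z 1"])
      (auto simp: V.representation_add V.representation_basis mult.commute[of _ "of_rat _"] V.representation_scale)
qed

text \<open>
  The hypothesis \<open>slow\<close> excludes roots \<open>z\<close> of the minimal polynomial \<open>\<mu>\<close> with \<open>norm z > 1\<close>: dividing
  \<open>\<mu>\<close> by the linear factor of \<open>z\<close> gives an operator that maps \<open>u\<close> to a nonzero geometric sequence with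
  ratio \<open>z\<close>, whose terms are bounded by finitely many consecutive terms of \<open>u\<close>. Then
  \<open>d = gcd \<mu> (pderiv \<mu>)\<close> collects the excess multiplicities, and the operator of \<open>d\<close>, after clearing
  denominators, maps \<open>u\<close> to an integer sequence \<open>H\<close> whose characteristic polynomial \<open>\<mu> / d\<close> has simple
  roots in the closed unit disc. So \<open>H\<close> is bounded, hence eventually periodic with some period \<open>M\<close>, and
  by minimality \<open>\<mu>\<close> divides a constant multiple of \<open>(x ^ M - 1) * d\<close>.
\<close>

lemma unity_roots_if_slow_growth:
  fixes u :: "nat \<Rightarrow> int" and f :: "rat poly"
  assumes f: "f \<noteq> 0" "\<forall>\<^sub>F n in sequentially. shift_op f (\<lambda>n. of_int (u n)) n = 0"
    and slow: "\<And>\<rho> n0 L. \<rho> > 1 \<Longrightarrow> \<exists>n\<ge>n0. \<forall>i<L. real_of_int \<bar>u (n + i)\<bar> < \<rho> ^ n"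
  shows "\<exists>M\<ge>1. \<exists>D. \<forall>\<^sub>F n in sequentially. shift_op ((monom 1 M - 1) ^ D) u n = 0"
proof -
  define uq where "uq n = rat_of_int (u n)" for n
  define uc where "uc n = complex_of_int (u n)" for n
  define Ann where "Ann p \<longleftrightarrow> (\<forall>\<^sub>F n in sequentially. shift_op p uq n = 0)" for p
  obtain \<mu> where mu: "\<mu> \<noteq> 0" "Ann \<mu>" and least: "\<And>p. p \<noteq> 0 \<Longrightarrow> Ann p \<Longrightarrow> degree \<mu> \<le> degree p"
    using ex_has_least_nat[of "\<lambda>p. p \<noteq> 0 \<and> Ann p" f degree] f unfolding Ann_def uq_def by blast
  have Ann_mult: "Ann (q * p)" if "Ann p" for p q
    using that eventually_shift_op_eq_0[of "shift_op p uq"] unfolding Ann_def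
    by (simp add: shift_op_mult)
  have Ann_dvd: "\<mu> dvd p" if "Ann p" for p
  proof -
    have "Ann (p - (p div \<mu>) * \<mu>)"
      using eventually_conj[OF that[unfolded Ann_def] Ann_mult[OF mu(2), of "p div \<mu>", unfolded Ann_def]]
      unfolding Ann_def by (rule eventually_mono) (simp add: shift_op_diff)
    then have "Ann (p mod \<mu>)" by (simp add: minus_div_mult_eq_mod)
    then have "p mod \<mu> = 0" using least[of "p mod \<mu>"] degree_mod_less[OF mu(1), of p] by force
    then show ?thesis by auto
  qed
  let ?C = "map_poly (of_rat :: rat \<Rightarrow> complex)"
  have to_C: "shift_op (?C p) uc n = of_rat (shift_op p uq n)" for p n
    by (rule shift_op_map_poly) (simp_all add: of_rat_add of_rat_mult uc_def uq_def)
  have root_le: "norm z \<le> 1" if z: "poly (?C \<mu>) z = 0" for z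
  proof (rule ccontr)
    assume big: "\<not> norm z \<le> 1"
    obtain q where q: "?C \<mu> = [:- z, 1:] * q" using z by (auto simp: poly_eq_0_iff_dvd)
    define w where "w = shift_op q uc"
    have C0: "?C \<mu> \<noteq> 0" using mu by (simp add: map_poly_eq_0_iff)
    have q0: "q \<noteq> 0" using q C0 by auto
    have deg: "degree \<mu> = Suc (degree q)"
    proof -
      have "degree (?C \<mu>) = degree \<mu>" by (rule degree_map_poly) simp
      then show ?thesis using q0 by (simp add: q degree_mult_eq del: mult_pCons_left)
    qed
    have lc: "lead_coeff q = of_rat (lead_coeff \<mu>)"
    proof -
      have "lead_coeff (?C \<mu>) = lead_coeff q" unfolding q by (subst lead_coeff_mult) simp
      then show ?thesis by (simp add: coeff_map_poly degree_map_poly)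
    qed
    obtain n0 where n0: "\<And>n. n \<ge> n0 \<Longrightarrow> shift_op \<mu> uq n = 0"
      using mu by (auto simp: Ann_def eventually_sequentially)
    have geo: "shift_op [:- z, 1:] w n = 0" if "n \<ge> n0" for n
      using to_C[of \<mu> n] n0[OF that] unfolding q w_def by (simp only: shift_op_mult of_rat_0)
    have "\<not> (\<forall>\<^sub>F n in sequentially. w n = 0)"
    proof
      assume w0: "\<forall>\<^sub>F n in sequentially. w n = 0"
      \<comment> \<open>Projecting the coefficients of \<open>q\<close> to the rationals contradicts the minimality of \<open>\<mu>\<close>. The projection does not kill \<open>q\<close>, because it fixes the rational leading coefficient.\<close>
      obtain \<phi> :: "complex \<Rightarrow> rat" where phi: "\<And>x y. \<phi> (x + y) = \<phi> x + \<phi> y"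
        "\<And>x r. \<phi> (x * of_rat r) = \<phi> x * r" "\<phi> 1 = 1"
        using rational_projection by blast
      have phi0: "\<phi> 0 = 0" using phi(1)[of 0 0] by simp
      have phi_uc: "\<phi> (x * uc n) = \<phi> x * uq n" for x n
        using phi(2)[of x "uq n"] by (simp add: uc_def uq_def)
      have "shift_op (map_poly \<phi> q) uq n = \<phi> (w n)" for n
        unfolding w_def by (rule shift_op_map_poly) (simp_all add: phi phi0 phi_uc)
      then have "Ann (map_poly \<phi> q)"
        using w0 unfolding Ann_def by (auto simp: phi0 elim: eventually_mono)
      moreover have "coeff (map_poly \<phi> q) (degree q) = lead_coeff \<mu>"
        using phi(2)[of 1 "lead_coeff \<mu>"] phi(3) by (simp add: coeff_map_poly phi0 lc)
      then have "map_poly \<phi> q \<noteq> 0" using mu by auto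
      ultimately have "degree \<mu> \<le> degree (map_poly \<phi> q)" by (intro least)
      then show False using map_poly_degree_leq[of \<phi> q] deg by linarith
    qed
    then obtain n1 where n1: "n1 \<ge> n0" "w n1 \<noteq> 0" by (auto simp: eventually_sequentially)
    have wk: "w (n1 + k) = z ^ k * w n1" for k
      using geo n1 by (intro geometric_of_shift_op) auto
    \<comment> \<open>A growth rate strictly between \<open>1\<close> and \<open>norm z\<close>.\<close>
    define \<rho> where "\<rho> = sqrt (norm z)"
    have rho: "\<rho> > 1" "norm z = \<rho> * \<rho>" using big by (simp_all add: \<rho>_def)
    define A where "A = (\<Sum>i\<le>degree q. norm (coeff q i))"
    obtain k0 where k0: "A * \<rho> ^ n1 / norm (w n1) < \<rho> ^ k0"
      using real_arch_pow[OF rho(1)] by blast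
    obtain n where n: "n \<ge> n1 + k0" "\<And>i. i < Suc (degree q) \<Longrightarrow> real_of_int \<bar>u (n + i)\<bar> < \<rho> ^ n"
      using slow[OF rho(1)] by blast
    define k where "k = n - n1"
    have k: "n = n1 + k" "k \<ge> k0" using n by (auto simp: k_def)
    have "norm (w n) \<le> (\<Sum>i\<le>degree q. norm (coeff q i) * \<rho> ^ n)"
      unfolding w_def shift_op_def
    proof (rule sum_norm_le)
      fix i assume "i \<in> {..degree q}"
      then have "real_of_int \<bar>u (n + i)\<bar> \<le> \<rho> ^ n" using n(2)[of i] by simp
      then show "norm (coeff q i * uc (n + i)) \<le> norm (coeff q i) * \<rho> ^ n"
        by (simp add: norm_mult uc_def mult_left_mono)
    qed
    also have "\<dots> = A * \<rho> ^ n1 * \<rho> ^ k" by (simp add: A_def sum_distrib_right k power_add mult.assoc)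
    also have "norm (w n) = \<rho> ^ k * \<rho> ^ k * norm (w n1)"
      by (simp add: k wk norm_mult norm_power rho(2) power_mult_distrib)
    finally have "(\<rho> ^ k * norm (w n1)) * \<rho> ^ k \<le> (A * \<rho> ^ n1) * \<rho> ^ k" by (simp add: mult_ac)
    then have "\<rho> ^ k * norm (w n1) \<le> A * \<rho> ^ n1" using rho by (simp add: mult.commute)
    moreover have "\<rho> ^ k0 \<le> \<rho> ^ k" using k rho by (intro power_increasing) auto
    then have "\<rho> ^ k0 * norm (w n1) \<le> \<rho> ^ k * norm (w n1)" by (intro mult_right_mono) auto
    moreover have "A * \<rho> ^ n1 < \<rho> ^ k0 * norm (w n1)" using k0 n1 by (simp add: field_simps)
    ultimately show False by linarith
  qed
  show ?thesis
  proof (cases "degree \<mu> = 0")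
    case True
    then obtain c where c: "\<mu> = [:c:]" "c \<noteq> 0" using mu(1) degree_0_id by (metis degree_eq_zeroE pCons_eq_0_iff)
    have "\<forall>\<^sub>F n in sequentially. shift_op ((monom 1 1 - 1) ^ 0) u n = 0"
      using mu(2) c unfolding Ann_def by (auto simp: uq_def elim: eventually_mono)
    then show ?thesis by blast
  next
    case False
    define d where "d = gcd \<mu> (pderiv \<mu>)"
    have "d dvd \<mu>" "d dvd pderiv \<mu>" by (simp_all add: d_def)
    then obtain \<sigma> e where dec: "\<mu> = \<sigma> * d" "pderiv \<mu> = e * d" by (metis dvd_def mult.commute)
    obtain r s where bez: "d = r * \<mu> + s * pderiv \<mu>"
      unfolding d_def by (metis bezout_coefficients_fst_snd)
    have C_add: "?C (x + y) = ?C x + ?C y" for x y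
      by (intro poly_eqI) (simp add: coeff_map_poly of_rat_add)
    have "pderiv \<mu> \<noteq> 0" using False by (simp add: pderiv_eq_0_iff)
    then have sf: "rsquarefree (?C \<sigma>) \<and> (\<forall>a. poly (?C \<sigma>) a = 0 \<longleftrightarrow> poly (?C \<mu>) a = 0)"
    proof (intro poly_squarefree_decomp)
      show "pderiv (?C \<mu>) \<noteq> 0"
        using \<open>pderiv \<mu> \<noteq> 0\<close> by (simp add: map_poly_eq_0_iff flip: map_poly_of_rat_pderiv)
      show "?C \<mu> = ?C \<sigma> * ?C d" using dec(1) by (metis map_poly_of_rat_mult)
      show "pderiv (?C \<mu>) = ?C e * ?C d" using dec(2) by (metis map_poly_of_rat_mult map_poly_of_rat_pderiv)
      show "?C d = ?C r * ?C \<mu> + ?C s * pderiv (?C \<mu>)"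
        by (subst bez) (simp add: C_add map_poly_of_rat_mult map_poly_of_rat_pderiv)
    qed
    have d0: "d \<noteq> 0" and s0: "\<sigma> \<noteq> 0" using mu(1) dec by auto
    obtain K P where KP: "K \<noteq> 0" "map_poly of_int P = smult (of_int K) d"
      using clear_denominators by blast
    define H where "H = shift_op P u"
    have Hq: "of_int (H n) = shift_op (smult (of_int K) d) uq n" for n
      unfolding H_def KP(2)[symmetric]
      by (rule shift_op_map_poly[symmetric]) (simp_all add: uq_def)
    have Hrec: "\<forall>\<^sub>F n in sequentially. shift_op \<sigma> (\<lambda>n. of_int (H n)) n = 0"
    proof -
      have "Ann (smult (of_int K) 1 * \<mu>)" using mu(2) by (rule Ann_mult)
      moreover have "smult (of_int K) 1 * \<mu> = \<sigma> * smult (of_int K) d" by (simp add: dec)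
      ultimately show ?thesis unfolding Ann_def Hq by (simp only: shift_op_mult)
    qed
    have "shift_op (?C \<sigma>) (\<lambda>n. of_int (H n)) n = of_rat (shift_op \<sigma> (\<lambda>n. of_int (H n)) n)" for n
      by (rule shift_op_map_poly) (simp_all add: of_rat_add of_rat_mult)
    then have "\<forall>\<^sub>F n in sequentially. shift_op (?C \<sigma>) (\<lambda>n. of_int (H n)) n = 0"
      using Hrec by (auto elim: eventually_mono)
    then obtain B where B: "\<forall>\<^sub>F n in sequentially. norm (complex_of_int (H n)) \<le> B"
      using bounded_if_simple_roots[of "?C \<sigma>"] sf root_le by blast
    have "\<forall>\<^sub>F n in sequentially. \<bar>H n\<bar> \<le> \<lceil>B\<rceil>"
      using B by (rule eventually_mono) (simp, linarith)
    then obtain M where M: "M \<ge> 1" "\<forall>\<^sub>F n in sequentially. H (n + M) = H n"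
      using eventually_periodic_if_bounded[OF s0 Hrec] by blast
    have "shift_op (smult (of_int K) d) uq = (\<lambda>n. of_int (H n))" by (rule ext) (simp only: Hq)
    then have shifted: "shift_op ((monom 1 M - 1) * smult (of_int K) d) uq n = of_int (H (n + M)) - of_int (H n)" for n
      by (simp only: shift_op_mult shift_op_diff shift_op_monom shift_op_1 mult_1_left)
    have "Ann ((monom 1 M - 1) * smult (of_int K) d)"
      unfolding Ann_def using M(2)
    proof (rule eventually_mono)
      fix n assume "H (n + M) = H n"
      then show "shift_op ((monom 1 M - 1) * smult (of_int K) d) uq n = 0"
        by (simp only: shifted diff_self)
    qed
    then have "\<mu> dvd smult (of_int K) ((monom 1 M - 1) * d)" using Ann_dvd by simp
    then have "\<sigma> * d dvd (monom 1 M - 1) * d" using KP(1) dec(1) by (simp add: dvd_smult_iff)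
    then have "\<sigma> dvd monom 1 M - 1" using d0 by simp
    then obtain \<tau> where tau: "monom 1 M - 1 = \<sigma> * \<tau>" by (auto elim: dvdE)
    let ?X = "monom 1 M - 1 :: complex poly"
    have "?C (monom 1 M - 1) = ?X"
      by (intro poly_eqI) (simp add: coeff_map_poly of_rat_diff)
    then have "?X = ?C \<sigma> * ?C \<tau>" using tau by (metis map_poly_of_rat_mult)
    then have "\<forall>z. poly (?C \<mu>) z = 0 \<longrightarrow> poly ?X z = 0" using sf by simp
    then have "?C \<mu> dvd ?X ^ degree (?C \<mu>)"
      using mu(1) by (subst (asm) nullstellensatz_univariate) (auto simp: map_poly_eq_0_iff)
    then obtain \<kappa> where kappa: "?X ^ degree (?C \<mu>) = \<kappa> * ?C \<mu>" by (metis dvd_def mult.commute)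
    have "\<forall>\<^sub>F n in sequentially. shift_op (?C \<mu>) uc n = 0"
      using mu(2) unfolding Ann_def to_C by (auto elim: eventually_mono)
    then have ann: "\<forall>\<^sub>F n in sequentially. shift_op (?X ^ degree (?C \<mu>)) uc n = 0"
      unfolding kappa shift_op_mult by (rule eventually_shift_op_eq_0)
    let ?Z = "map_poly (of_int :: int \<Rightarrow> complex)"
    have X: "?Z (monom 1 M - 1) = ?X" by (intro poly_eqI) (simp add: coeff_map_poly)
    have "?Z ((monom 1 M - 1) ^ k) = ?X ^ k" for k
      by (induction k) (simp_all add: X map_poly_mult_hom)
    moreover have "shift_op (?Z p) uc n = of_int (shift_op p u n)" for p n
      by (rule shift_op_map_poly) (simp_all add: uc_def)
    ultimately have descend: "shift_op (?X ^ k) uc n = of_int (shift_op ((monom 1 M - 1) ^ k) u n)" for k n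
      by metis
    have "\<forall>\<^sub>F n in sequentially. shift_op ((monom 1 M - 1) ^ degree (?C \<mu>)) u n = 0"
      using ann unfolding descend of_int_eq_0_iff .
    then show ?thesis using M(1) by blast
  qed
qed

section \<open>Congruences modulo large primes\<close>

lemma prime_dvd_power_add:
  fixes x y :: "'a::comm_ring_1"
  assumes "prime p"
  shows "of_nat p dvd (x + y) ^ p - x ^ p - y ^ p"
proof -
  have p0: "p > 0" using assms prime_gt_0_nat by blast
  have "(x + y) ^ p = (\<Sum>k\<in>{..p}. of_nat (p choose k) * x ^ k * y ^ (p - k))"
    by (rule binomial_ring)
  also have "{..p} = insert 0 (insert p {0<..<p})" by auto
  also have "(\<Sum>k\<in>\<dots>. of_nat (p choose k) * x ^ k * y ^ (p - k))
      = y ^ p + (x ^ p + (\<Sum>k\<in>{0<..<p}. of_nat (p choose k) * x ^ k * y ^ (p - k)))"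
    using p0 by simp
  finally have "(x + y) ^ p - x ^ p - y ^ p = (\<Sum>k\<in>{0<..<p}. of_nat (p choose k) * x ^ k * y ^ (p - k))"
    by simp
  also have "of_nat p dvd \<dots>"
  proof (rule dvd_sum)
    fix k assume "k \<in> {0<..<p}"
    then have "p dvd (p choose k)" using assms by (intro dvd_choose_prime) auto
    then obtain m where "p choose k = p * m" by (auto elim: dvdE)
    then have "(of_nat p :: 'a) dvd of_nat (p choose k)" by simp
    then show "(of_nat p :: 'a) dvd of_nat (p choose k) * x ^ k * y ^ (p - k)"
      by (simp add: mult.assoc)
  qed
  finally show ?thesis .
qed

text \<open>
  Since \<open>p \<ge> D\<close>, also \<open>(x ^ M - 1) ^ p\<close> annihilates \<open>u\<close>, and modulo \<open>p\<close> this polynomial is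
  \<open>x ^ (M * p) - 1\<close>.
\<close>

lemma congruent_shift_if_unipotent:
  fixes u :: "nat \<Rightarrow> int"
  assumes ann: "\<And>n. n \<ge> n0 \<Longrightarrow> shift_op ((monom 1 M - 1) ^ D) u n = 0"
    and p: "prime p" "odd p" "p \<ge> D" and n: "n \<ge> n0"
  shows "int p dvd u (n + M * p * t) - u n"
proof -
  let ?X = "monom 1 M - 1 :: int poly"
  have one: "int p dvd u (n + M * p) - u n" if n: "n \<ge> n0" for n
  proof -
    have "of_nat p dvd (monom 1 M + (-1)) ^ p - monom 1 M ^ p - (-1 :: int poly) ^ p"
      by (rule prime_dvd_power_add[OF p(1)])
    then obtain r where "?X ^ p - monom 1 M ^ p - (-1) ^ p = of_nat p * r" by (auto elim: dvdE)
    then have X: "?X ^ p = monom 1 (M * p) - 1 + smult (int p) r"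
      using p(2) by (simp add: monom_power algebra_simps of_nat_poly)
    have "?X ^ p = ?X ^ (p - D) * ?X ^ D" using p(3) by (simp flip: power_add)
    then have "shift_op (?X ^ p) u n = shift_op (?X ^ (p - D)) (shift_op (?X ^ D) u) n"
      by (simp only: shift_op_mult)
    also have "\<dots> = 0" using ann n by (rule shift_op_eq_0)
    finally have "u (n + M * p) - u n = int p * (- shift_op r u n)"
      unfolding X by (simp add: shift_op_add shift_op_diff shift_op_smult shift_op_monom)
    then show ?thesis by simp
  qed
  show ?thesis
  proof (induction t)
    case (Suc t)
    have "int p dvd (u (n + M * p * t + M * p) - u (n + M * p * t)) + (u (n + M * p * t) - u n)"
      using Suc one[of "n + M * p * t"] n by (intro dvd_add) auto
    then show ?case by (simp add: algebra_simps)
  qed simp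
qed


text \<open>
  Fermat's little theorem: \<open>x ^ p - x\<close> is additive in \<open>x\<close> modulo \<open>p\<close>.
\<close>

lemma prime_dvd_power_minus_self:
  assumes "prime p" "x \<ge> 0"
  shows "int p dvd x ^ p - x"
  using assms(2)
proof (induction x rule: int_ge_induct)
  case base
  show ?case using assms(1) prime_gt_0_nat by (auto simp: zero_power)
next
  case (step x)
  have "int p dvd (x + 1) ^ p - x ^ p - 1 ^ p"
    using prime_dvd_power_add[OF assms(1), of x 1] by simp
  then have "int p dvd ((x + 1) ^ p - x ^ p - 1 ^ p) + (x ^ p - x)" using step by (intro dvd_add)
  also have "((x + 1) ^ p - x ^ p - 1 ^ p) + (x ^ p - x) = (x + 1) ^ p - (x + 1)" by simp
  finally show ?case .
qed

lemma prime_dvd_power_multiple_minus_one: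
  assumes "prime p" "x > 0" "x < int p"
  shows "int p dvd x ^ ((p - 1) * k) - 1"
proof -
  have p: "prime (int p)" using assms by simp
  have "x ^ p = x * x ^ (p - 1)" using assms prime_gt_0_nat[of p] by (simp flip: power_Suc)
  then have "int p dvd x * (x ^ (p - 1) - 1)"
    using prime_dvd_power_minus_self[OF assms(1), of x] assms(2) by (simp add: algebra_simps)
  moreover have "\<not> int p dvd x" using assms zdvd_not_zless by blast
  ultimately have "int p dvd x ^ (p - 1) - 1" using prime_dvd_multD[OF p] by blast
  moreover have "x ^ (p - 1) - 1 dvd (x ^ (p - 1)) ^ k - 1" by (metis dvd_triv_left power_diff_1_eq)
  ultimately show ?thesis by (metis dvd_trans power_mult)
qed

text \<open>
  The fixed index is a multiple \<open>n = M * Suc n0\<close> of \<open>M\<close>. Modulo \<open>p - 1\<close> a shift by \<open>M * p * k\<close> is a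
  shift by \<open>M * k\<close>, and \<open>k = (p - 2) * Suc n0\<close> is congruent to \<open>- Suc n0\<close>; so the shifted index is a
  multiple of \<open>p - 1\<close>. There \<open>p\<close> divides the gcd, hence also \<open>gcd_seq a b n\<close>, although \<open>p\<close> can be
  taken larger than this positive number.
\<close>

lemma gcd_seq_not_unipotent:
  assumes ab: "a \<ge> 2" "b \<ge> 2" and M: "M \<ge> 1"
  shows "\<not> (\<forall>\<^sub>F n in sequentially. shift_op ((monom 1 M - 1) ^ D) (gcd_seq a b) n = 0)"
proof
  assume "\<forall>\<^sub>F n in sequentially. shift_op ((monom 1 M - 1) ^ D) (gcd_seq a b) n = 0"
  then obtain n0 where "\<forall>n\<ge>n0. shift_op ((monom 1 M - 1) ^ D) (gcd_seq a b) n = 0"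
    by (auto simp: eventually_sequentially)
  then have n0: "\<And>n. n \<ge> Suc n0 \<Longrightarrow> shift_op ((monom 1 M - 1) ^ D) (gcd_seq a b) n = 0" by auto
  define n where "n = M * Suc n0"
  have n: "n \<ge> Suc n0" "n \<ge> 1" using mult_le_mono1[OF M, of "Suc n0"] by (auto simp: n_def)
  obtain p where p: "prime p" "p > D + nat a + nat b + nat (gcd_seq a b n) + 2"
    using bigger_prime by blast
  have "odd p" using p by (intro prime_odd_nat) auto
  have index: "n + M * p * ((p - 2) * Suc n0) = (p - 1) * ((p - 1) * n)"
  proof -
    obtain q where q: "p = q + 2" using p by (metis le_add_diff_inverse2 le_add2 less_imp_le order_trans)
    show ?thesis by (simp add: n_def q algebra_simps)
  qed
  have "int p dvd gcd_seq a b (n + M * p * ((p - 2) * Suc n0)) - gcd_seq a b n"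
    by (rule congruent_shift_if_unipotent[OF n0 p(1) \<open>odd p\<close> _ n(1)]) (use p in auto)
  moreover have "int p dvd gcd_seq a b (n + M * p * ((p - 2) * Suc n0))"
    unfolding index gcd_seq_def using p ab
    by (intro gcd_greatest prime_dvd_power_multiple_minus_one) auto
  ultimately have "int p dvd gcd_seq a b (n + M * p * ((p - 2) * Suc n0))
      - (gcd_seq a b (n + M * p * ((p - 2) * Suc n0)) - gcd_seq a b n)"
    by (rule dvd_diff[rotated])
  then have "int p dvd gcd_seq a b n" by simp
  moreover have "gcd_seq a b n > 0" using ab n by (intro gcd_seq_pos)
  ultimately have "int p \<le> gcd_seq a b n" by (rule zdvd_imp_le)
  then show False using p by linarith
qed

section \<open>The equivalence and the formula\<close>

lemma mult_dependent_if_tail_lin_rec: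
  assumes ab: "a \<ge> 2" "b \<ge> 2" and rec: "satisfies_lin_rec (\<lambda>n. gcd_seq a b (n + N))"
  shows "mult_dependent a b"
proof (rule ccontr)
  assume indep: "\<not> mult_dependent a b"
  obtain d c where d: "d \<ge> 1" and c: "\<And>n. n \<ge> 1 \<Longrightarrow>
      gcd_seq a b (n + d + N) = (\<Sum>i = 1..d. c i * gcd_seq a b (n + d - i + N))"
    using rec unfolding satisfies_lin_rec_def by blast
  define f :: "rat poly" where "f = monom 1 d - (\<Sum>i=1..d. monom (of_int (c i)) (d - i))"
  have "coeff (\<Sum>i=1..d. monom (rat_of_int (c i)) (d - i)) d = 0"
    unfolding coeff_sum by (intro sum.neutral) auto
  then have "coeff f d = 1" by (simp add: f_def)
  then have f0: "f \<noteq> 0" by auto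
  have "shift_op f (\<lambda>n. of_int (gcd_seq a b n)) n = 0" if n: "n \<ge> N + 1" for n
  proof -
    obtain m where m: "n = m + N" "m \<ge> 1" using n by (metis add.commute le_Suc_ex add.assoc le_add1)
    have "(\<Sum>i=1..d. rat_of_int (c i) * of_int (gcd_seq a b (n + (d - i))))
       = (\<Sum>i=1..d. of_int (c i * gcd_seq a b (m + d - i + N)))"
      by (intro sum.cong refl) (simp add: m(1) add_ac)
    also have "\<dots> = of_int (gcd_seq a b (n + d))"
      using c[OF m(2)] by (simp add: m(1) add_ac)
    finally show ?thesis by (simp add: f_def shift_op_diff shift_op_sum shift_op_monom)
  qed
  then have f: "\<forall>\<^sub>F n in sequentially. shift_op f (\<lambda>n. of_int (gcd_seq a b n)) n = 0"
    by (auto simp: eventually_sequentially)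
  have slow: "\<exists>n\<ge>n0. \<forall>i<L. real_of_int \<bar>gcd_seq a b (n + i)\<bar> < \<rho> ^ n" if "\<rho> > 1" for \<rho> n0 L
  proof -
    have "ln \<rho> > 0" using that by simp
    then obtain n where n: "n \<ge> max n0 1" "\<forall>i<max L 1. ln (gcd_seq a b (n + i)) < ln \<rho> * n"
      using exists_run_of_small_gcds[OF ab indep, of "ln \<rho>" "max L 1" "max n0 1"] by auto
    have "real_of_int \<bar>gcd_seq a b (n + i)\<bar> < \<rho> ^ n" if "i < L" for i
    proof -
      have pos: "gcd_seq a b (n + i) > 0" using n ab by (intro gcd_seq_pos) auto
      have "ln (gcd_seq a b (n + i)) < ln \<rho> * n" using n(2) that by simp
      also have "\<dots> = ln (\<rho> ^ n)" using \<open>\<rho> > 1\<close> by (simp add: ln_realpow mult.commute)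
      finally show ?thesis using pos \<open>\<rho> > 1\<close> by (subst (asm) ln_less_cancel_iff) auto
    qed
    then show ?thesis using n by auto
  qed
  show False
    using unity_roots_if_slow_growth[OF f0 f slow] gcd_seq_not_unipotent[OF ab] by blast
qed

text \<open>
  Descent on \<open>a + b\<close>: if \<open>a < b\<close> then \<open>v < u\<close>, so \<open>a ^ v\<close> divides \<open>b ^ v\<close> and hence \<open>b = a * q\<close>. Now
  \<open>a ^ (u - v) = q ^ v\<close> is a smaller relation, and a common base of \<open>a\<close> and \<open>q\<close> is one of \<open>b\<close> as well.
\<close>

lemma common_base:
  fixes a b :: int
  assumes "a \<ge> 2" "b \<ge> 2" "u \<ge> 1" "v \<ge> 1" "a ^ u = b ^ v"
  shows "\<exists>c r s. c \<ge> 2 \<and> r \<ge> 1 \<and> s \<ge> 1 \<and> a = c ^ r \<and> b = c ^ s"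
  using assms
proof (induction "nat (a + b)" arbitrary: a b u v rule: less_induct)
  case less
  have step: "\<exists>c r s. c \<ge> 2 \<and> r \<ge> 1 \<and> s \<ge> 1 \<and> a = c ^ r \<and> b = c ^ s"
    if h: "a \<ge> 2" "a < b" "u \<ge> 1" "v \<ge> 1" "a ^ u = b ^ v"
      and IH: "\<And>a' b' u' v'. nat (a' + b') < nat (a + b) \<Longrightarrow> a' \<ge> 2 \<Longrightarrow> b' \<ge> 2 \<Longrightarrow> u' \<ge> 1 \<Longrightarrow> v' \<ge> 1
          \<Longrightarrow> a' ^ u' = b' ^ v' \<Longrightarrow> \<exists>c r s. c \<ge> 2 \<and> r \<ge> 1 \<and> s \<ge> 1 \<and> a' = c ^ r \<and> b' = c ^ s"
    for a b :: int and u v :: nat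
  proof -
    have "a ^ v < a ^ u" using h by (simp add: power_strict_mono)
    then have uv: "v < u" by (rule power_less_imp_less_exp[rotated]) (use h in simp)
    have "a ^ v dvd b ^ v" using uv h(5) by (metis le_imp_power_dvd less_imp_le_nat)
    then have "a dvd b" using h by simp
    then obtain q where q: "b = a * q" by (auto elim: dvdE)
    have "0 < a * q" "a * 1 < a * q" using h q by auto
    then have q2: "q \<ge> 2" using h by (simp add: mult_less_cancel_left_pos)
    have "a ^ v * a ^ (u - v) = a ^ v * q ^ v"
      using h(5) uv by (simp add: q power_mult_distrib flip: power_add)
    then have "a ^ (u - v) = q ^ v" using h by simp
    moreover have "q < b" using q q2 h by simp
    moreover have "u - v \<ge> 1" using uv by simp
    ultimately obtain c r s where c: "c \<ge> 2" "r \<ge> 1" "s \<ge> 1" "a = c ^ r" "q = c ^ s"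
      using IH[of a q "u - v" v] h q2 uv by auto
    then have "b = c ^ (r + s)" by (simp add: q power_add)
    then show ?thesis using c by (metis trans_le_add1)
  qed
  consider "a = b" | "a < b" | "b < a" by linarith
  then show ?case
  proof cases
    case 1
    then show ?thesis using less.prems by (intro exI[of _ a] exI[of _ 1]) auto
  next
    case 2
    show ?thesis by (rule step[OF _ 2]) (use less in auto)
  next
    case 3
    have "\<exists>c r s. c \<ge> 2 \<and> r \<ge> 1 \<and> s \<ge> 1 \<and> b = c ^ r \<and> a = c ^ s"
      by (rule step[OF _ 3, of v u]) (use less in \<open>auto simp: add.commute\<close>)
    then show ?thesis by blast
  qed
qed

lemma gcd_seq_powers:
  assumes "c \<ge> 1"
  shows "gcd_seq (c ^ r) (c ^ s) n = c ^ (gcd r s * n) - 1"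
proof -
  have "gcd_seq (c ^ r) (c ^ s) n = gcd (c ^ (r * n) - 1) (c ^ (s * n) - 1)"
    by (simp add: gcd_seq_def power_mult)
  also have "\<dots> = c ^ gcd (r * n) (s * n) - 1" using assms by (rule gcd_power_minus_one)
  also have "gcd (r * n) (s * n) = gcd r s * n" by (simp add: gcd_mult_distrib_nat mult.commute)
  finally show ?thesis .
qed

lemma lin_rec_power_minus_one: "satisfies_lin_rec (\<lambda>n. x ^ n - 1)"
  unfolding satisfies_lin_rec_def
proof (intro exI conjI allI impI)
  let ?c = "\<lambda>i. if i = 1 then x + 1 else - x"
  show "x ^ (n + 2) - 1 = (\<Sum>i=1..2. ?c i * (x ^ (n + 2 - i) - 1))" for n
  proof -
    have "{1..2::nat} = {1, 2}" by auto
    then show ?thesis by (simp add: algebra_simps)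
  qed
qed simp

theorem theorem1p1:
  fixes a b :: int
  assumes "a \<ge> 2" and "b \<ge> 2"
  shows "(mult_dependent a b \<longleftrightarrow> satisfies_lin_rec (gcd_seq a b))
    \<and> (satisfies_lin_rec (gcd_seq a b)
         \<longleftrightarrow> (\<exists>N :: nat. satisfies_lin_rec (\<lambda>n. gcd_seq a b (n + N))))
    \<and> (mult_dependent a b \<longrightarrow>
         (\<exists>(c :: int) (r :: nat) (s :: nat).
            c \<ge> 2 \<and> r \<ge> 1 \<and> s \<ge> 1 \<and> a = c ^ r \<and> b = c ^ s)
       \<and> (\<forall>(c :: int) (r :: nat) (s :: nat).
            c \<ge> 2 \<and> r \<ge> 1 \<and> s \<ge> 1 \<and> a = c ^ r \<and> b = c ^ s \<longrightarrow>
            (\<forall>n\<ge>1. gcd_seq a b n = c ^ (gcd r s * n) - 1)))"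
proof -
  let ?P = "\<lambda>c r s. c \<ge> 2 \<and> r \<ge> 1 \<and> s \<ge> 1 \<and> a = c ^ r \<and> b = c ^ s"
  have formula: "gcd_seq a b n = c ^ (gcd r s * n) - 1" if "?P c r s" for c r s n
    using that gcd_seq_powers[of c r s n] by simp
  have base: "\<exists>c r s. ?P c r s" if "mult_dependent a b"
    using that common_base[OF assms] unfolding mult_dependent_def by blast
  have "satisfies_lin_rec (gcd_seq a b)" if dep: "mult_dependent a b"
  proof -
    obtain c r s where P: "?P c r s" using base[OF dep] by blast
    have "gcd_seq a b = (\<lambda>n. (c ^ gcd r s) ^ n - 1)"
      using formula[OF P] by (auto simp: power_mult)
    then show ?thesis using lin_rec_power_minus_one by simp
  qed
  moreover have "\<exists>N. satisfies_lin_rec (\<lambda>n. gcd_seq a b (n + N))" if "satisfies_lin_rec (gcd_seq a b)"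
    using that by (intro exI[of _ 0]) simp
  moreover have "mult_dependent a b" if "\<exists>N. satisfies_lin_rec (\<lambda>n. gcd_seq a b (n + N))"
    using that mult_dependent_if_tail_lin_rec[OF assms] by blast
  ultimately show ?thesis using base formula by blast
qed

end
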